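(* In the setting of part 1 (so $\omega\in B(H)$ invertible, $\mathrm{Tr}(\omega^\dagger\omega)=1$, $T_{ij}=(1_{Y_j}\otimes\omega)\tilde\tau_{ij}$), suppose $M$ is entanglement-reversible with respect to $W_\omega$, and let $\kappa_{ij}$ be invertible operators such that each $V_j:\bigoplus_i(X_i\otimes E_{ji})\to Y_j\otimes H$, $(\xi_i)_i\mapsto\sum_iT_{ij}(1\otimes\kappa_{ij})\xi_i$, is an isometry. Let $U_i:X_i\otimes H\to\bigoplus_j(Y_j\otimes E_{ji})$, $\xi\mapsto(\tau_{ij}\xi)_j$ (always an isometry). Then $\dim A\le\dim B$; all the maps $U_i$ and $V_j$ are unitary if and only if $\dim A=\dim B$; and in that case the entanglement-left inverse of $M$ with respect to $W_\omega$ is unique and is given by $N\big(\bigoplus_j\rho_j\big)=\bigoplus_i\sum_j\mathrm{Tr}_{E_{ji}}\big[(1_{X_i}\otimes\kappa_{ij}^\dagger)T_{ij}^\dagger\rho_jT_{ij}(1_{X_i}\otimes\kappa_{ij})\big]$ for $\rho_j\in B(Y_j\otimes H)$.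
   Context: All Hilbert spaces are finite-dimensional. A channel is a completely positive trace-preserving linear map (acting on states). $A=\bigoplus_{i=1}^mB(X_i)$, $B=\bigoplus_{j=1}^nB(Y_j)$, $\dim A=\sum_i(\dim X_i)^2$, $A\otimes B(H)=\bigoplus_iB(X_i\otimes H)$; a channel $M:A\otimes B(H)\to B$ has components $M_{ij}:B(X_i\otimes H)\to B(Y_j)$ with $M(\oplus_i\rho_i)=\oplus_j\sum_iM_{ij}(\rho_i)$. A minimal dilation of $M$ is a family of linear maps $\tau_{ij}:X_i\otimes H\to Y_j\otimes E_{ji}$ with $M_{ij}(\rho)=\mathrm{Tr}_{E_{ji}}(\tau_{ij}\rho\tau_{ij}^\dagger)$ such that, for an orthonormal basis $\{e_k\}$ of $E_{ji}$, the operators $(1\otimes\langle e_k|)\tau_{ij}$ are linearly independent. With a fixed orthonormal basis $\{|h\rangle\}$ of $H$ and fixed orthonormal bases $\{e_k\}$ of the $E_{ji}$, $\tilde\tau_{ij}:X_i\otimes E_{ji}\to Y_j\otimes H$ is the linear map $\tilde\tau_{ij}(x\otimes e_k)=\sum_h[(1\otimes\langle e_k|)\tau_{ij}(x\otimes|h\rangle)]\otimes|h\rangle$. $W_\omega=|w_\omega\rangle\langle w_\omega|$ with $|w_\omega\rangle=\sum_h|h\rangle\otimes\omega|h\rangle\in H\otimes H$. Entanglement-reversibility: for a state $W$ on $H_1\otimes H_2$, a channel $M:A\otimes B(H_1)\to B$ is entanglement-reversible with respect to $W$ if there is a channel $N:B\otimes B(H_2)\to A$ (entanglement-left inverse) with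 $N\big((M\otimes\mathrm{id}_{B(H_2)})(\rho\otimes W)\big)=\rho$ for all $\rho\in A$. Here $H_1=H_2=H$. *)

theory Defs
  imports "Jordan_Normal_Form.Schur_Decomposition"
begin

text \<open>Conventions.  All Hilbert spaces are C^k with the standard basis.  Operators are
  complex matrices.  The tensor product of C^a and C^b is C^(a*b) with basis index
  x*b + y for the basis vector e_x (x) e_y (Kronecker convention).  An element of a
  direct sum of matrix algebras  B(C^(dims 0)) + ... + B(C^(dims (m-1)))  is a
  function  nat => complex mat  whose i-th value (i < m) is a dims i x dims i matrix.\<close>

definition tensor_mat :: "complex mat \<Rightarrow> complex mat \<Rightarrow> complex mat" where
  "tensor_mat A B = mat (dim_row A * dim_row B) (dim_col A * dim_col B)
     (\<lambda>(i,j). A $$ (i div dim_row B, j div dim_col B) * B $$ (i mod dim_row B, j mod dim_col B))"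

definition ptrace2 :: "nat \<Rightarrow> nat \<Rightarrow> complex mat \<Rightarrow> complex mat" where
  "ptrace2 n k R = mat n n (\<lambda>(a,b). \<Sum>e<k. R $$ (a*k+e, b*k+e))"

definition mtrace :: "complex mat \<Rightarrow> complex" where
  "mtrace A = (\<Sum>i<dim_row A. A $$ (i,i))"

definition msum :: "nat \<Rightarrow> nat \<Rightarrow> nat set \<Rightarrow> (nat \<Rightarrow> complex mat) \<Rightarrow> complex mat" where
  "msum r c J F = mat r c (\<lambda>(a,b). \<Sum>k\<in>J. F k $$ (a,b))"

definition adj :: "complex mat \<Rightarrow> complex mat" where
  "adj A = mat_adjoint A"

definition isometry_mat :: "complex mat \<Rightarrow> bool" where
  "isometry_mat V \<longleftrightarrow> adj V * V = 1\<^sub>m (dim_col V)"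

definition unitary_mat :: "complex mat \<Rightarrow> bool" where
  "unitary_mat V \<longleftrightarrow> adj V * V = 1\<^sub>m (dim_col V) \<and> V * adj V = 1\<^sub>m (dim_row V)"

definition psd_mat :: "nat \<Rightarrow> complex mat \<Rightarrow> bool" where
  "psd_mat n A \<longleftrightarrow> A \<in> carrier_mat n n \<and>
     (\<forall>v \<in> carrier_vec n. Im (conjugate v \<bullet> (A *\<^sub>v v)) = 0 \<and> Re (conjugate v \<bullet> (A *\<^sub>v v)) \<ge> 0)"

definition mm_carrier :: "nat \<Rightarrow> (nat \<Rightarrow> nat) \<Rightarrow> (nat \<Rightarrow> complex mat) set" where
  "mm_carrier m dims = {\<rho>. \<forall>i<m. \<rho> i \<in> carrier_mat (dims i) (dims i)}"

definition mm_psd :: "nat \<Rightarrow> (nat \<Rightarrow> nat) \<Rightarrow> (nat \<Rightarrow> complex mat) \<Rightarrow> bool" where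
  "mm_psd m dims \<rho> \<longleftrightarrow> (\<forall>i<m. psd_mat (dims i) (\<rho> i))"

definition mm_trace :: "nat \<Rightarrow> (nat \<Rightarrow> complex mat) \<Rightarrow> complex" where
  "mm_trace m \<rho> = (\<Sum>i<m. mtrace (\<rho> i))"

definition mm_dim :: "nat \<Rightarrow> (nat \<Rightarrow> nat) \<Rightarrow> nat" where
  "mm_dim m dims = (\<Sum>i<m. dims i ^ 2)"

definition mm_single :: "(nat \<Rightarrow> nat) \<Rightarrow> nat \<Rightarrow> complex mat \<Rightarrow> nat \<Rightarrow> complex mat" where
  "mm_single dims i \<rho> = (\<lambda>i'. if i' = i then \<rho> else 0\<^sub>m (dims i') (dims i'))"

text \<open>Given a map M from (+)_i B(C^(dIn i)) to (+)_j B(C^(dOut j)), the map M (x) id_{B(C^k)}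
  from (+)_i B(C^(dIn i) (x) C^k) to (+)_j B(C^(dOut j) (x) C^k):
  (M (x) id)(sum_{a,b} rho^{ab} (x) |a><b|) = sum_{a,b} M(rho^{ab}) (x) |a><b|.\<close>
definition tensor_id_map ::
  "(nat \<Rightarrow> nat) \<Rightarrow> (nat \<Rightarrow> nat) \<Rightarrow> nat \<Rightarrow>
   ((nat \<Rightarrow> complex mat) \<Rightarrow> (nat \<Rightarrow> complex mat)) \<Rightarrow> (nat \<Rightarrow> complex mat) \<Rightarrow> (nat \<Rightarrow> complex mat)" where
  "tensor_id_map dIn dOut k M \<rho> = (\<lambda>j. mat (dOut j * k) (dOut j * k) (\<lambda>(r,c).
      M (\<lambda>i. mat (dIn i) (dIn i) (\<lambda>(p,q). \<rho> i $$ (p*k + r mod k, q*k + c mod k))) j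
        $$ (r div k, c div k)))"

definition mm_linear ::
  "nat \<Rightarrow> (nat \<Rightarrow> nat) \<Rightarrow> nat \<Rightarrow> (nat \<Rightarrow> nat) \<Rightarrow> ((nat \<Rightarrow> complex mat) \<Rightarrow> (nat \<Rightarrow> complex mat)) \<Rightarrow> bool" where
  "mm_linear m dIn n dOut M \<longleftrightarrow>
     (\<forall>\<rho> \<in> mm_carrier m dIn. M \<rho> \<in> mm_carrier n dOut) \<and>
     (\<forall>\<rho> \<in> mm_carrier m dIn. \<forall>\<sigma> \<in> mm_carrier m dIn. \<forall>a b :: complex. \<forall>j<n.
        M (\<lambda>i. a \<cdot>\<^sub>m \<rho> i + b \<cdot>\<^sub>m \<sigma> i) j = a \<cdot>\<^sub>m M \<rho> j + b \<cdot>\<^sub>m M \<sigma> j)"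

definition completely_positive ::
  "nat \<Rightarrow> (nat \<Rightarrow> nat) \<Rightarrow> nat \<Rightarrow> (nat \<Rightarrow> nat) \<Rightarrow> ((nat \<Rightarrow> complex mat) \<Rightarrow> (nat \<Rightarrow> complex mat)) \<Rightarrow> bool" where
  "completely_positive m dIn n dOut M \<longleftrightarrow>
     (\<forall>k. \<forall>\<rho> \<in> mm_carrier m (\<lambda>i. dIn i * k). mm_psd m (\<lambda>i. dIn i * k) \<rho> \<longrightarrow>
        mm_psd n (\<lambda>j. dOut j * k) (tensor_id_map dIn dOut k M \<rho>))"

definition trace_preserving ::
  "nat \<Rightarrow> (nat \<Rightarrow> nat) \<Rightarrow> nat \<Rightarrow> ((nat \<Rightarrow> complex mat) \<Rightarrow> (nat \<Rightarrow> complex mat)) \<Rightarrow> bool" where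
  "trace_preserving m dIn n M \<longleftrightarrow> (\<forall>\<rho> \<in> mm_carrier m dIn. mm_trace n (M \<rho>) = mm_trace m \<rho>)"

definition channel ::
  "nat \<Rightarrow> (nat \<Rightarrow> nat) \<Rightarrow> nat \<Rightarrow> (nat \<Rightarrow> nat) \<Rightarrow> ((nat \<Rightarrow> complex mat) \<Rightarrow> (nat \<Rightarrow> complex mat)) \<Rightarrow> bool" where
  "channel m dIn n dOut M \<longleftrightarrow> mm_linear m dIn n dOut M \<and> completely_positive m dIn n dOut M
     \<and> trace_preserving m dIn n M"

text \<open>(1 (x) <e_k|) tau for tau : C^a -> C^p (x) C^q: a p x a matrix.\<close>
definition slice_op :: "nat \<Rightarrow> nat \<Rightarrow> complex mat \<Rightarrow> nat \<Rightarrow> complex mat" where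
  "slice_op p q \<tau> k = mat p (dim_col \<tau>) (\<lambda>(y,c). \<tau> $$ (y*q + k, c))"

definition lin_indep_mats :: "nat \<Rightarrow> (nat \<Rightarrow> complex mat) \<Rightarrow> nat \<Rightarrow> nat \<Rightarrow> bool" where
  "lin_indep_mats e F r c \<longleftrightarrow>
     (\<forall>a :: nat \<Rightarrow> complex. msum r c {..<e} (\<lambda>k. a k \<cdot>\<^sub>m F k) = 0\<^sub>m r c \<longrightarrow> (\<forall>k<e. a k = 0))"

text \<open>A minimal dilation of M : A (x) B(H) -> B, where A = (+)_{i<m} B(C^(dx i)),
  B = (+)_{j<n} B(C^(dy j)), H = C^d, E_{ji} = C^(de j i), tau i j : X_i (x) H -> Y_j (x) E_{ji}.\<close>
definition minimal_dilation ::
  "nat \<Rightarrow> (nat \<Rightarrow> nat) \<Rightarrow> nat \<Rightarrow> (nat \<Rightarrow> nat) \<Rightarrow> nat \<Rightarrow> (nat \<Rightarrow> nat \<Rightarrow> nat) \<Rightarrow>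
   ((nat \<Rightarrow> complex mat) \<Rightarrow> (nat \<Rightarrow> complex mat)) \<Rightarrow> (nat \<Rightarrow> nat \<Rightarrow> complex mat) \<Rightarrow> bool" where
  "minimal_dilation m dx n dy d de M \<tau> \<longleftrightarrow>
     (\<forall>i<m. \<forall>j<n. \<tau> i j \<in> carrier_mat (dy j * de j i) (dx i * d) \<and>
        (\<forall>\<rho> \<in> carrier_mat (dx i * d) (dx i * d).
           M (mm_single (\<lambda>i'. dx i' * d) i \<rho>) j = ptrace2 (dy j) (de j i) (\<tau> i j * \<rho> * adj (\<tau> i j))) \<and>
        lin_indep_mats (de j i) (slice_op (dy j) (de j i) (\<tau> i j)) (dy j) (dx i * d))"

text \<open>tau~ : X (x) E -> Y (x) H,  tau~(x (x) e_k) = sum_h [(1 (x) <e_k|) tau (x (x) |h>)] (x) |h>.\<close>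
definition tilde_op :: "nat \<Rightarrow> nat \<Rightarrow> nat \<Rightarrow> nat \<Rightarrow> complex mat \<Rightarrow> complex mat" where
  "tilde_op nx ny nh ne \<tau> = mat (ny * nh) (nx * ne)
     (\<lambda>(r,c). \<tau> $$ ((r div nh) * ne + c mod ne, (c div ne) * nh + r mod nh))"

text \<open>w_omega = sum_h |h> (x) omega|h>, W_omega = |w_omega><w_omega|.\<close>
definition w_vec :: "nat \<Rightarrow> complex mat \<Rightarrow> complex vec" where
  "w_vec d \<omega> = vec (d * d) (\<lambda>r. \<omega> $$ (r mod d, r div d))"

definition W_state :: "nat \<Rightarrow> complex mat \<Rightarrow> complex mat" where
  "W_state d \<omega> = mat (d * d) (d * d) (\<lambda>(r,c). w_vec d \<omega> $ r * cnj (w_vec d \<omega> $ c))"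

definition ent_left_inverse ::
  "nat \<Rightarrow> (nat \<Rightarrow> nat) \<Rightarrow> nat \<Rightarrow> (nat \<Rightarrow> nat) \<Rightarrow> nat \<Rightarrow> nat \<Rightarrow> complex mat \<Rightarrow>
   ((nat \<Rightarrow> complex mat) \<Rightarrow> (nat \<Rightarrow> complex mat)) \<Rightarrow> ((nat \<Rightarrow> complex mat) \<Rightarrow> (nat \<Rightarrow> complex mat)) \<Rightarrow> bool" where
  "ent_left_inverse m dx n dy d1 d2 W M N \<longleftrightarrow>
     channel n (\<lambda>j. dy j * d2) m dx N \<and>
     (\<forall>\<rho> \<in> mm_carrier m dx. \<forall>i<m.
        N (tensor_id_map (\<lambda>i. dx i * d1) dy d2 M (\<lambda>i. tensor_mat (\<rho> i) W)) i = \<rho> i)"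

definition ent_reversible ::
  "nat \<Rightarrow> (nat \<Rightarrow> nat) \<Rightarrow> nat \<Rightarrow> (nat \<Rightarrow> nat) \<Rightarrow> nat \<Rightarrow> nat \<Rightarrow> complex mat \<Rightarrow>
   ((nat \<Rightarrow> complex mat) \<Rightarrow> (nat \<Rightarrow> complex mat)) \<Rightarrow> bool" where
  "ent_reversible m dx n dy d1 d2 W M \<longleftrightarrow> (\<exists>N. ent_left_inverse m dx n dy d1 d2 W M N)"

fun block_row :: "nat \<Rightarrow> nat \<Rightarrow> (nat \<Rightarrow> complex mat) \<Rightarrow> complex mat" where
  "block_row r 0 F = 0\<^sub>m r 0"
| "block_row r (Suc k) F = four_block_mat (block_row r k F) (F k)
     (0\<^sub>m 0 (dim_col (block_row r k F))) (0\<^sub>m 0 (dim_col (F k)))"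

fun block_col :: "nat \<Rightarrow> nat \<Rightarrow> (nat \<Rightarrow> complex mat) \<Rightarrow> complex mat" where
  "block_col c 0 F = 0\<^sub>m 0 c"
| "block_col c (Suc k) F = four_block_mat (block_col c k F) (0\<^sub>m (dim_row (block_col c k F)) 0)
     (F k) (0\<^sub>m (dim_row (F k)) 0)"

end

theory Submission
  imports Defs
begin

text \<open>
  Trace preservation makes each \<open>U\<^sub>i\<close> an isometry, so comparing dimensions for the isometries \<open>U\<^sub>i\<close>
  and \<open>V\<^sub>j\<close> gives
  \<open>d dim A \<le> \<Sum>\<^sub>i\<^sub>j dim X\<^sub>i dim Y\<^sub>j dim E\<^sub>j\<^sub>i \<le> d dim B\<close>,
  with equality exactly when all of them are square, i.e. unitary.

  For uniqueness, the channel \<open>\<rho> \<mapsto> (M \<otimes> id)(\<rho> \<otimes> W)\<close> has the Kraus operators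
  \<open>t\<^sub>k : x \<mapsto> T\<^sub>i\<^sub>j (x \<otimes> e\<^sub>k)\<close>.  If \<open>N\<close> inverts it, then \<open>N\<close> maps
  \<open>\<Sum>\<^sub>j\<^sub>k |t\<^sub>k x\<rangle>\<langle>t\<^sub>k x|\<close> to \<open>|x\<rangle>\<langle>x|\<close>; by positivity every \<open>(t\<^sub>k x) \<otimes> z\<close> with
  \<open>\<Sum>\<^sub>l z\<^sub>l x\<^sub>l = 0\<close> (or \<open>z\<close> in another block) is a null vector of the Choi form of \<open>N\<close>, hence lies in
  its kernel.  This determines \<open>N\<close> on the operators \<open>|s\<rangle>\<langle>s'|\<close>, where \<open>s\<close>, \<open>s'\<close> are columns
  of \<open>V\<^sub>j\<close>, up to scalars that trace preservation fixes.  When \<open>V\<^sub>j\<close> is unitary these operators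
  span everything.
\<close>

section \<open>Null vectors of positive sesquilinear forms\<close>

lemma hermitian_affine_nonneg_zero:
  fixes A B E :: complex
  assumes h: "\<And>b. Im (b * A + cnj b * B + E) = 0 \<and> Re (b * A + cnj b * B + E) \<ge> 0"
  shows "A = 0" "B = 0"
proof -
  \<comment> \<open>Comparing imaginary parts at \<open>b = 1\<close> and \<open>b = \<i>\<close>
    with those at \<open>b = 0\<close> forces \<open>B = cnj A\<close>.\<close>
  have "Im B = - Im A" using h[of 1] h[of 0] by simp
  moreover have "Re B = Re A" using h[of \<i>] h[of 0] by simp
  ultimately have B: "B = cnj A" by (simp add: complex_eq_iff)
  \<comment> \<open>Along \<open>b = - t * cnj A\<close> the real part is affine in \<open>t\<close>
    with slope \<open>-2 |A|^2\<close>, so it stays nonnegative for all real \<open>t\<close> only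
    if \<open>A = 0\<close>.\<close>
  have *: "0 \<le> Re E - 2 * t * ((Re A)\<^sup>2 + (Im A)\<^sup>2)" for t :: real
    using h[of "- of_real t * cnj A"] by (simp add: B power2_eq_square algebra_simps)
  show "A = 0"
  proof (rule ccontr)
    assume "A \<noteq> 0"
    then have pos: "(Re A)\<^sup>2 + (Im A)\<^sup>2 > 0"
      by (simp add: complex_eq_iff sum_power2_gt_zero_iff)
    obtain r where r: "r * ((Re A)\<^sup>2 + (Im A)\<^sup>2) = Re E + 1"
      using pos by (metis less_irrefl nonzero_eq_divide_eq)
    then have "0 \<le> Re E - 2 * (Re E + 1)" using *[of r] by (simp add: mult.assoc)
    with *[of 0] show False by simp
  qed
  then show "B = 0" using B by simp
qed

text \<open>The value at |u\<rangle>\<langle>v| of the linear functional on matrices that sends the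
  matrix unit \<open>(x, y)\<close> to \<open>c x y\<close>.\<close>

definition sform :: "nat \<Rightarrow> (nat \<Rightarrow> nat \<Rightarrow> complex) \<Rightarrow> (nat \<Rightarrow> complex) \<Rightarrow> (nat \<Rightarrow> complex) \<Rightarrow> complex" where
  "sform D c u v = (\<Sum>x<D. \<Sum>y<D. u x * cnj (v y) * c x y)"

lemma sform_sum_left:
  "sform D c (\<lambda>x. \<Sum>k\<in>A. z k * u k x) v = (\<Sum>k\<in>A. z k * sform D c (u k) v)"
  unfolding sform_def sum_distrib_left sum_distrib_right
  by (subst sum.swap, rule sum.cong[OF refl], subst sum.swap)
     (simp add: mult_ac sum.swap[of _ A])

lemma sform_sum_right:
  "sform D c u (\<lambda>x. \<Sum>k\<in>A. z k * v k x) = (\<Sum>k\<in>A. cnj (z k) * sform D c u (v k))"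
  unfolding sform_def sum_distrib_left sum_distrib_right cnj_sum
  by (simp add: mult_ac sum.swap[of _ A])

lemma sform_add_left: "sform D c (\<lambda>x. u x + u' x) v = sform D c u v + sform D c u' v"
  by (simp add: sform_def sum.distrib algebra_simps)

lemma sform_add_right: "sform D c u (\<lambda>x. v x + v' x) = sform D c u v + sform D c u v'"
  by (simp add: sform_def sum.distrib algebra_simps)

lemma sform_scale_left: "sform D c (\<lambda>x. z * u x) v = z * sform D c u v"
  by (simp add: sform_def sum_distrib_left mult_ac)

lemma sform_scale_right: "sform D c u (\<lambda>x. z * v x) = cnj z * sform D c u v"
  by (simp add: sform_def sum_distrib_left mult_ac)

lemma sform_zero [simp]: "sform D c (\<lambda>x. 0) v = 0" "sform D c u (\<lambda>x. 0) = 0"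
  by (simp_all add: sform_def)

text \<open>The sesquilinear form of a Choi matrix: \<open>c x y l l'\<close> is meant as the
  \<open>(l, l')\<close> entry of the image of the matrix unit \<open>(x, y)\<close>, and the family
  of the \<open>\<psi> l\<close> encodes one vector of the tensor product of the output and input
  spaces.\<close>

definition choi_form ::
  "nat \<Rightarrow> nat \<Rightarrow> (nat \<Rightarrow> nat \<Rightarrow> nat \<Rightarrow> nat \<Rightarrow> complex) \<Rightarrow> (nat \<Rightarrow> nat \<Rightarrow> complex) \<Rightarrow> (nat \<Rightarrow> nat \<Rightarrow> complex) \<Rightarrow> complex" where
  "choi_form D K c \<psi> \<phi> = (\<Sum>l<K. \<Sum>l'<K. sform D (\<lambda>x y. c x y l l') (\<psi> l) (\<phi> l'))"

lemma choi_form_add_scaled: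
  "choi_form D K c (\<lambda>l x. b * \<psi> l x + \<phi> l x) (\<lambda>l x. b * \<psi> l x + \<phi> l x) =
     b * cnj b * choi_form D K c \<psi> \<psi> + b * choi_form D K c \<psi> \<phi>
     + cnj b * choi_form D K c \<phi> \<psi> + choi_form D K c \<phi> \<phi>"
  by (simp add: choi_form_def sform_add_left sform_add_right sform_scale_left sform_scale_right
      sum.distrib sum_distrib_left algebra_simps)

text \<open>The Cauchy-Schwarz argument: adding \<open>b\<close> times a null family to
  \<open>\<phi>\<close> leaves an expression without quadratic term in \<open>b\<close>, and
  nonnegativity for all \<open>b\<close> kills the cross terms.\<close>

lemma choi_form_null:
  assumes pos: "\<And>\<psi>. Im (choi_form D K c \<psi> \<psi>) = 0 \<and> Re (choi_form D K c \<psi> \<psi>) \<ge> 0"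
    and null: "choi_form D K c \<psi> \<psi> = 0"
  shows "choi_form D K c \<psi> \<phi> = 0" "choi_form D K c \<phi> \<psi> = 0"
proof -
  have "Im (b * choi_form D K c \<psi> \<phi> + cnj b * choi_form D K c \<phi> \<psi> + choi_form D K c \<phi> \<phi>) = 0 \<and>
        Re (b * choi_form D K c \<psi> \<phi> + cnj b * choi_form D K c \<phi> \<psi> + choi_form D K c \<phi> \<phi>) \<ge> 0" for b
    using pos[of "\<lambda>l x. b * \<psi> l x + \<phi> l x"] unfolding choi_form_add_scaled null by simp
  from hermitian_affine_nonneg_zero[OF this]
  show "choi_form D K c \<psi> \<phi> = 0" "choi_form D K c \<phi> \<psi> = 0" by blast+
qed

lemma choi_form_product:
  "choi_form D K c (\<lambda>l x. z l * u x) (\<lambda>l x. z l * u x) =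
     (\<Sum>l<K. \<Sum>l'<K. z l * cnj (z l') * sform D (\<lambda>x y. c x y l l') u u)"
  by (simp add: choi_form_def sform_scale_left sform_scale_right mult.assoc)

text \<open>Testing against a family concentrated at one index \<open>s\<close> turns a kernel
  statement about the Choi form into a linear relation between the functionals
  \<open>c x y l s\<close>.\<close>

lemma choi_form_single_right:
  assumes "s < K"
  shows "choi_form D K c (\<lambda>l x. z l * u x) (\<lambda>l x. if l = s then v x else 0) =
     (\<Sum>l<K. z l * sform D (\<lambda>x y. c x y l s) u v)"
proof -
  have "sform D g (\<lambda>x. z l * u x) (\<lambda>x. if l' = s then v x else 0) =
      (if l' = s then z l * sform D g u v else 0)" for g l l'
    by (simp add: sform_scale_left)
  then show ?thesis using assms by (simp add: choi_form_def)
qed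

lemma choi_form_single_left:
  assumes "s < K"
  shows "choi_form D K c (\<lambda>l x. if l = s then v x else 0) (\<lambda>l x. z l * u x) =
     (\<Sum>l<K. cnj (z l) * sform D (\<lambda>x y. c x y s l) v u)"
proof -
  have "sform D g (\<lambda>x. if l' = s then v x else 0) (\<lambda>x. z l * u x) =
      (if l' = s then cnj (z l) * sform D g v u else 0)" for g l l'
    by (simp add: sform_scale_right)
  then show ?thesis unfolding choi_form_def using assms by (subst sum.swap) simp
qed

section \<open>Coefficients of a left inverse on the Kraus vectors\<close>

text \<open>\<open>C j i x y r s\<close> stands for the \<open>(r, s)\<close> entry in block
  \<open>i\<close> of the inverse applied to the matrix unit \<open>(x, y)\<close> of block
  \<open>j\<close>, and \<open>t j i p k\<close> for the vector
  \<open>T_ij (e_p \<otimes> e_k)\<close>. The assumptions express complete positivity, the inverse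
  property on rank-one inputs |\<xi>\<rangle>\<langle>\<xi>| in block \<open>i'\<close>, and trace
  preservation.\<close>

locale inverse_coeffs =
  fixes m n :: nat and K D :: "nat \<Rightarrow> nat" and E :: "nat \<Rightarrow> nat \<Rightarrow> nat"
    and C :: "nat \<Rightarrow> nat \<Rightarrow> nat \<Rightarrow> nat \<Rightarrow> nat \<Rightarrow> nat \<Rightarrow> complex"
    and t :: "nat \<Rightarrow> nat \<Rightarrow> nat \<Rightarrow> nat \<Rightarrow> nat \<Rightarrow> complex"
  assumes choi: "\<And>i j \<psi>. i < m \<Longrightarrow> j < n \<Longrightarrow>
      Im (choi_form (D j) (K i) (C j i) \<psi> \<psi>) = 0 \<and> Re (choi_form (D j) (K i) (C j i) \<psi> \<psi>) \<ge> 0"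
    and left_inverse: "\<And>i i' r s \<xi>. i < m \<Longrightarrow> i' < m \<Longrightarrow> r < K i \<Longrightarrow> s < K i \<Longrightarrow>
      (\<Sum>j<n. \<Sum>k<E j i'. sform (D j) (\<lambda>x y. C j i x y r s)
         (\<lambda>x. \<Sum>p<K i'. \<xi> p * t j i' p k x) (\<lambda>x. \<Sum>p<K i'. \<xi> p * t j i' p k x)) =
      (if i = i' then \<xi> r * cnj (\<xi> s) else 0)"
    and trace_pres: "\<And>j u v. j < n \<Longrightarrow>
      (\<Sum>i<m. \<Sum>r<K i. sform (D j) (\<lambda>x y. C j i x y r r) u v) = (\<Sum>x<D j. u x * cnj (v x))"
begin

abbreviation \<nu> where "\<nu> j i r s \<equiv> sform (D j) (\<lambda>x y. C j i x y r s)"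

text \<open>The numbers \<open>q j k\<close> are nonnegative and, by the inverse property, add up to
  the squared modulus of \<Sum> \<open>z l * \<xi> l\<close> if \<open>i = i'\<close> and to
  \<open>0\<close> otherwise. Under \<open>orth\<close> the total vanishes, hence so does each of
  them.\<close>

lemma null_choi:
  assumes "i < m" "i' < m" "j < n" "k < E j i'"
    and orth: "i \<noteq> i' \<or> (\<Sum>l<K i. z l * \<xi> l) = 0"
  defines "u \<equiv> \<lambda>j k x. \<Sum>p<K i'. \<xi> p * t j i' p k x"
  shows "choi_form (D j) (K i) (C j i) (\<lambda>l x. z l * u j k x) (\<lambda>l x. z l * u j k x) = 0"
proof -
  define q where "q j k = choi_form (D j) (K i) (C j i) (\<lambda>l x. z l * u j k x) (\<lambda>l x. z l * u j k x)" for j k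
  have q: "Im (q j k) = 0 \<and> Re (q j k) \<ge> 0" if "j < n" for j k
    unfolding q_def by (rule choi[OF assms(1) that])
  have "(\<Sum>j<n. \<Sum>k<E j i'. q j k) =
     (\<Sum>l<K i. \<Sum>l'<K i. z l * cnj (z l') * (\<Sum>j<n. \<Sum>k<E j i'. \<nu> j i l l' (u j k) (u j k)))"
    unfolding q_def choi_form_product sum_distrib_left
    by (subst sum.swap[of _ "{..<K i}" "{..<E _ i'}"], subst sum.swap[of _ "{..<K i}" "{..<E _ i'}"],
        subst sum.swap[of _ "{..<n}" "{..<K i}"], subst sum.swap[of _ "{..<n}" "{..<K i}"]) simp
  also have "\<dots> = (\<Sum>l<K i. \<Sum>l'<K i. z l * cnj (z l') * (if i = i' then \<xi> l * cnj (\<xi> l') else 0))"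
    unfolding u_def using assms by (intro sum.cong refl) (simp add: left_inverse)
  also have "\<dots> = (if i = i' then (\<Sum>l<K i. z l * \<xi> l) * cnj (\<Sum>l'<K i. z l' * \<xi> l') else 0)"
    by (simp add: sum_product mult_ac)
  also have "\<dots> = 0" using orth by auto
  finally have "Re (\<Sum>j<n. \<Sum>k<E j i'. q j k) = 0" by simp
  then have "(\<Sum>j<n. \<Sum>k<E j i'. Re (q j k)) = 0" by simp
  then have "\<forall>j<n. (\<Sum>k<E j i'. Re (q j k)) = 0"
    using q by (subst (asm) sum_nonneg_eq_0_iff) (auto intro!: sum_nonneg)
  then have "Re (q j k) = 0"
    using q[OF assms(3)] assms(3,4) by (auto simp: sum_nonneg_eq_0_iff)
  then show ?thesis using q[OF assms(3)] unfolding q_def[symmetric] by (simp add: complex_eq_iff)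
qed

text \<open>The null family lies in the kernel on either side; here it is tested against
  \<open>v\<close> placed at the single index \<open>s\<close>.\<close>

lemma null_sums:
  assumes "i < m" "i' < m" "j < n" "k < E j i'" "s < K i"
    and orth: "i \<noteq> i' \<or> (\<Sum>l<K i. z l * \<xi> l) = 0"
  shows "(\<Sum>l<K i. z l * \<nu> j i l s (\<lambda>x. \<Sum>p<K i'. \<xi> p * t j i' p k x) v) = 0"
    and "(\<Sum>l<K i. cnj (z l) * \<nu> j i s l v (\<lambda>x. \<Sum>p<K i'. \<xi> p * t j i' p k x)) = 0"
  unfolding choi_form_single_left[OF assms(5), symmetric] choi_form_single_right[OF assms(5), symmetric]
  using choi_form_null[OF choi null_choi] assms by blast+

lemma t_sum_delta:
  "p < K i \<Longrightarrow> (\<lambda>x. \<Sum>p'<K i. (if p' = p then 1 else 0) * t j i p' k x) = t j i p k"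
  by (simp add: if_distrib[of "\<lambda>z. z * _"] cong: if_cong)

lemma t_sum_delta2:
  assumes "p < K i" "q < K i"
  shows "(\<lambda>x. \<Sum>p'<K i. ((if p' = p then 1 else 0) + (if p' = q then 1 else 0)) * t j i p' k x)
     = (\<lambda>x. t j i p k x + t j i q k x)"
  using assms by (simp add: distrib_right sum.distrib if_distrib[of "\<lambda>z. z * _"] cong: if_cong)

text \<open>With \<open>z\<close> and \<open>\<xi>\<close> the basis vectors at \<open>r\<close> and
  \<open>p\<close>, the orthogonality condition holds as soon as the blocks or the indices differ.
  The other argument \<open>v\<close> stays arbitrary.\<close>

lemma \<nu>_t_off:
  assumes "i < m" "i' < m" "j < n" "k < E j i'" "s < K i" "r < K i" "p < K i'"
    and "i \<noteq> i' \<or> r \<noteq> p"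
  shows "\<nu> j i r s (t j i' p k) v = 0" "\<nu> j i s r v (t j i' p k) = 0"
proof -
  have o: "i \<noteq> i' \<or> (\<Sum>l<K i. (if l = r then 1 else 0) * (if l = p then 1 else 0 :: complex)) = 0"
    using assms by (auto intro!: sum.neutral)
  show "\<nu> j i r s (t j i' p k) v = 0"
    using null_sums(1)[OF assms(1-5) o, of v] t_sum_delta[OF assms(7), of j k] assms(6)
    by (simp add: if_distrib[of "\<lambda>z. z * _"] if_distrib[of cnj] cong: if_cong)
  show "\<nu> j i s r v (t j i' p k) = 0"
    using null_sums(2)[OF assms(1-5) o, of v] t_sum_delta[OF assms(7), of j k] assms(6)
    by (simp add: if_distrib[of "\<lambda>z. z * _"] if_distrib[of cnj] cong: if_cong)
qed

text \<open>With \<open>z = e_p - e_q\<close> and \<open>\<xi> = e_p + e_q\<close> the mixed terms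
  vanish by \<open>\<nu>_t_off\<close>, and what remains says that the two diagonal values agree. So
  the value does not depend on \<open>p\<close>.\<close>

lemma \<nu>_t_diag:
  assumes "i < m" "j < n" "k < E j i" "s < K i" "p < K i" "q < K i"
  shows "\<nu> j i p s (t j i p k) v = \<nu> j i q s (t j i q k) v"
    and "\<nu> j i s p v (t j i p k) = \<nu> j i s q v (t j i q k)"
proof -
  let ?z = "\<lambda>l. (if l = p then 1 else 0) - (if l = q then 1 else 0 :: complex)"
  let ?x = "\<lambda>l. (if l = p then 1 else 0) + (if l = q then 1 else 0 :: complex)"
  have o: "i \<noteq> i \<or> (\<Sum>l<K i. ?z l * ?x l) = 0"
  proof -
    \<comment> \<open>On the support of \<open>?z\<close> the vector \<open>?x\<close> has value
      \<open>1\<close>, and the entries of \<open>?z\<close> cancel.\<close>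
    have "(\<Sum>l<K i. ?z l * ?x l) = (\<Sum>l<K i. ?z l)" if "p \<noteq> q"
      using that by (intro sum.cong) auto
    then show ?thesis using assms by (cases "p = q") (simp_all add: sum_subtractf)
  qed
  have z: "(\<Sum>l<K i. ?z l * f l) = f p - f q" "(\<Sum>l<K i. cnj (?z l) * f l) = f p - f q" for f
    using assms by (simp_all add: left_diff_distrib sum_subtractf
        if_distrib[of "\<lambda>z. z * _"] if_distrib[of cnj] cong: if_cong)
  show "\<nu> j i p s (t j i p k) v = \<nu> j i q s (t j i q k) v"
  proof (cases "p = q")
    case False
    then show ?thesis
    using null_sums(1)[OF assms(1) assms(1-4) o, of v] assms \<nu>_t_off(1)[OF assms(1) assms(1-4)]
    unfolding t_sum_delta2[OF assms(5,6)] z sform_add_left by auto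
  qed simp
  show "\<nu> j i s p v (t j i p k) = \<nu> j i s q v (t j i q k)"
  proof (cases "p = q")
    case False
    then show ?thesis
    using null_sums(2)[OF assms(1) assms(1-4) o, of v] assms \<nu>_t_off(2)[OF assms(1) assms(1-4)]
    unfolding t_sum_delta2[OF assms(5,6)] z sform_add_right by auto
  qed simp
qed

end

text \<open>\<open>w j i p a\<close> models the image of \<open>e_p \<otimes> e_a\<close> under
  \<open>T_ij (1 \<otimes> \<kappa>_ij)\<close>, a column of the \<open>i\<close>-th block of
  \<open>V_j\<close>. Orthonormality is stated for columns that share \<open>i\<close> and
  \<open>p\<close>, which are the pairs compared through trace preservation.\<close>

locale inverse_coeffs_basis = inverse_coeffs +
  fixes kap :: "nat \<Rightarrow> nat \<Rightarrow> nat \<Rightarrow> nat \<Rightarrow> complex"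
    and w :: "nat \<Rightarrow> nat \<Rightarrow> nat \<Rightarrow> nat \<Rightarrow> nat \<Rightarrow> complex"
  defines "w \<equiv> \<lambda>j i p a x. \<Sum>k<E j i. kap j i k a * t j i p k x"
  assumes orthonormal: "\<And>j i p a b. j < n \<Longrightarrow> i < m \<Longrightarrow> p < K i \<Longrightarrow> a < E j i \<Longrightarrow> b < E j i \<Longrightarrow>
      (\<Sum>x<D j. w j i p a x * cnj (w j i p b x)) = (if a = b then 1 else 0)"
begin

lemma \<nu>_w_off:
  assumes "i < m" "i' < m" "j < n" "s < K i" "r < K i" "p < K i'"
    and "i \<noteq> i' \<or> r \<noteq> p"
  shows "\<nu> j i r s (w j i' p a) v = 0" "\<nu> j i s r v (w j i' p a) = 0"
  unfolding w_def sform_sum_left sform_sum_right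
  using \<nu>_t_off[OF assms(1-3) _ assms(4-)] by (simp_all add: sum.neutral)

lemma \<nu>_w_diag:
  assumes "i < m" "j < n" "s < K i" "p < K i" "q < K i"
  shows "\<nu> j i p s (w j i p a) v = \<nu> j i q s (w j i q a) v"
    and "\<nu> j i s p v (w j i p a) = \<nu> j i s q v (w j i q a)"
proof -
  show "\<nu> j i p s (w j i p a) v = \<nu> j i q s (w j i q a) v"
    unfolding w_def sform_sum_left
  proof (rule sum.cong[OF refl])
    fix k assume "k \<in> {..<E j i}"
    then have k: "k < E j i" by simp
    show "kap j i k a * \<nu> j i p s (t j i p k) v = kap j i k a * \<nu> j i q s (t j i q k) v"
      unfolding \<nu>_t_diag(1)[OF assms(1,2) k assms(3-)] ..
  qed
  show "\<nu> j i s p v (w j i p a) = \<nu> j i s q v (w j i q a)"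
    unfolding w_def sform_sum_right
  proof (rule sum.cong[OF refl])
    fix k assume "k \<in> {..<E j i}"
    then have k: "k < E j i" by simp
    show "cnj (kap j i k a) * \<nu> j i s p v (t j i p k) = cnj (kap j i k a) * \<nu> j i s q v (t j i q k)"
      unfolding \<nu>_t_diag(2)[OF assms(1,2) k assms(3-)] ..
  qed
qed

text \<open>In the trace identity at the two columns every term except \<open>i' = i\<close>,
  \<open>r = p\<close> vanishes by \<open>\<nu>_w_off\<close>, so the surviving term equals their
  inner product.\<close>

lemma \<nu>_w_same:
  assumes "i < m" "j < n" "p < K i" "a < E j i" "b < E j i"
  shows "\<nu> j i p p (w j i p a) (w j i p b) = (if a = b then 1 else 0)"
proof -
  have "(\<Sum>r<K i'. \<nu> j i' r r (w j i p a) (w j i p b)) =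
      (\<Sum>r<K i'. if i' = i \<and> r = p then \<nu> j i p p (w j i p a) (w j i p b) else 0)" if "i' < m" for i'
    using assms that by (intro sum.cong refl) (auto intro!: \<nu>_w_off)
  then have "(\<Sum>i'<m. \<Sum>r<K i'. \<nu> j i' r r (w j i p a) (w j i p b)) =
      (\<Sum>i'<m. if i' = i then \<Sum>r<K i. if r = p then \<nu> j i p p (w j i p a) (w j i p b) else 0 else 0)"
    by (intro sum.cong refl) auto
  also have "\<dots> = \<nu> j i p p (w j i p a) (w j i p b)"
    using assms by simp
  finally show ?thesis
    using trace_pres[OF assms(2), of "w j i p a" "w j i p b"] orthonormal assms by simp
qed

text \<open>If the indices match, \<open>\<nu>_w_diag\<close> moves the second argument from
  \<open>s\<close> to \<open>r\<close>, where trace preservation gives the value; otherwise one of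
  the two arguments is off-diagonal.\<close>

lemma \<nu>_w:
  assumes "i < m" "i1 < m" "i2 < m" "j < n" "r < K i" "s < K i" "p < K i1" "q < K i2"
    "a < E j i1" "b < E j i2"
  shows "\<nu> j i r s (w j i1 p a) (w j i2 q b) =
     (if i1 = i \<and> i2 = i \<and> p = r \<and> q = s \<and> a = b then 1 else 0)"
proof (cases "i1 = i \<and> i2 = i \<and> p = r \<and> q = s")
  case True
  then show ?thesis
    using \<nu>_w_diag(2)[of i j r s r "w j i r a" b] \<nu>_w_same[of i j r a b] assms by simp
next
  case False
  then show ?thesis
    using \<nu>_w_off(1)[OF assms(1,2,4,6,5,7), of a] \<nu>_w_off(2)[OF assms(1,3,4,5,6,8), of _ b] by auto
qed

end

text \<open>Inserting the resolution of the identity on both sides writes \<rho> as the sum of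
  \<langle>W \<alpha>|\<rho>|W \<beta>\<rangle> |W \<alpha>\<rangle>\<langle>W \<beta>|; the
  functional is then applied termwise.\<close>

lemma sform_resolution:
  fixes W :: "'a \<Rightarrow> nat \<Rightarrow> complex"
  assumes res: "\<And>x y. x < D \<Longrightarrow> y < D \<Longrightarrow> (\<Sum>\<alpha>\<in>P. W \<alpha> x * cnj (W \<alpha> y)) = (if x = y then 1 else 0)"
  shows "(\<Sum>x<D. \<Sum>y<D. \<rho> x y * c x y) =
    (\<Sum>\<alpha>\<in>P. \<Sum>\<beta>\<in>P. (\<Sum>x<D. \<Sum>y<D. cnj (W \<alpha> x) * \<rho> x y * W \<beta> y) * sform D c (W \<alpha>) (W \<beta>))"
proof -
  let ?Q = "{..<D} \<times> {..<D}"
  have swap: "(\<Sum>a\<in>A. (\<Sum>z\<in>B. f a z) * (\<Sum>z'\<in>B. g a z')) = (\<Sum>z\<in>B. \<Sum>z'\<in>B. \<Sum>a\<in>A. f a z * g a z')"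
    for A :: "('a \<times> 'a) set" and B :: "(nat \<times> nat) set" and f g :: "_ \<Rightarrow> _ \<Rightarrow> complex"
    unfolding sum_product by (subst sum.swap, rule sum.cong[OF refl], rule sum.swap)
  \<comment> \<open>Packing the indices into pairs reduces the rearrangement to one application of
    \<open>swap\<close>.\<close>
  have "(\<Sum>\<alpha>\<in>P. \<Sum>\<beta>\<in>P. (\<Sum>x<D. \<Sum>y<D. cnj (W \<alpha> x) * \<rho> x y * W \<beta> y) * sform D c (W \<alpha>) (W \<beta>))
    = (\<Sum>(\<alpha>, \<beta>)\<in>P \<times> P. (\<Sum>(x, y)\<in>?Q. cnj (W \<alpha> x) * \<rho> x y * W \<beta> y) *
        (\<Sum>(x', y')\<in>?Q. W \<alpha> x' * cnj (W \<beta> y') * c x' y'))"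
    unfolding sform_def sum.cartesian_product ..
  also have "\<dots> = (\<Sum>a\<in>P \<times> P. (\<Sum>z\<in>?Q. cnj (W (fst a) (fst z)) * \<rho> (fst z) (snd z) * W (snd a) (snd z)) *
        (\<Sum>z'\<in>?Q. W (fst a) (fst z') * cnj (W (snd a) (snd z')) * c (fst z') (snd z')))"
    by (simp add: case_prod_unfold)
  also have "\<dots> = (\<Sum>z\<in>?Q. \<Sum>z'\<in>?Q. \<Sum>a\<in>P \<times> P.
        (cnj (W (fst a) (fst z)) * \<rho> (fst z) (snd z) * W (snd a) (snd z)) *
        (W (fst a) (fst z') * cnj (W (snd a) (snd z')) * c (fst z') (snd z')))"
    by (rule swap)
  \<comment> \<open>For fixed \<open>z\<close> and \<open>z'\<close> the sum over pairs factors into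
    two resolutions of the identity, which leave only \<open>z' = z\<close>.\<close>
  also have "\<dots> = (\<Sum>z\<in>?Q. \<Sum>z'\<in>?Q. if z' = z then \<rho> (fst z) (snd z) * c (fst z) (snd z) else 0)"
  proof (intro sum.cong refl)
    fix z z' assume z: "z \<in> ?Q" "z' \<in> ?Q"
    have "(\<Sum>a\<in>P \<times> P. (cnj (W (fst a) (fst z)) * \<rho> (fst z) (snd z) * W (snd a) (snd z)) *
        (W (fst a) (fst z') * cnj (W (snd a) (snd z')) * c (fst z') (snd z')))
      = (\<rho> (fst z) (snd z) * c (fst z') (snd z')) *
        (\<Sum>a\<in>P \<times> P. (W (fst a) (fst z') * cnj (W (fst a) (fst z))) * (W (snd a) (snd z) * cnj (W (snd a) (snd z'))))"
      unfolding sum_distrib_left by (intro sum.cong refl) (simp add: mult_ac)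
    also have "(\<Sum>a\<in>P \<times> P. (W (fst a) (fst z') * cnj (W (fst a) (fst z))) * (W (snd a) (snd z) * cnj (W (snd a) (snd z'))))
      = (\<Sum>\<alpha>\<in>P. W \<alpha> (fst z') * cnj (W \<alpha> (fst z))) * (\<Sum>\<beta>\<in>P. W \<beta> (snd z) * cnj (W \<beta> (snd z')))"
      unfolding sum_product sum.cartesian_product by (simp add: case_prod_unfold)
    also have "\<dots> = (if z' = z then 1 else 0)"
      using z by (auto simp: res split: if_splits)
    finally show "(\<Sum>a\<in>P \<times> P. (cnj (W (fst a) (fst z)) * \<rho> (fst z) (snd z) * W (snd a) (snd z)) *
        (W (fst a) (fst z') * cnj (W (snd a) (snd z')) * c (fst z') (snd z'))) =
        (if z' = z then \<rho> (fst z) (snd z) * c (fst z) (snd z) else 0)"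
      by simp
  qed
  also have "\<dots> = (\<Sum>z\<in>?Q. \<rho> (fst z) (snd z) * c (fst z) (snd z))"
    by (intro sum.cong refl) (simp add: sum.delta)
  also have "\<dots> = (\<Sum>x<D. \<Sum>y<D. \<rho> x y * c x y)"
    unfolding sum.cartesian_product by (simp add: case_prod_unfold)
  finally show ?thesis by simp
qed

section \<open>Adjoints, isometries and block matrices\<close>

lemma dim_adj [simp]: "dim_row (adj A) = dim_col A" "dim_col (adj A) = dim_row A"
  by (simp_all add: adj_def mat_adjoint_def)

lemma index_adj [simp]: "i < dim_col A \<Longrightarrow> j < dim_row A \<Longrightarrow> adj A $$ (i, j) = cnj (A $$ (j, i))"
  by (simp add: adj_def mat_adjoint_def mat_of_rows_index)

lemma index_mult_mat_sum:
  "i < dim_row A \<Longrightarrow> j < dim_col B \<Longrightarrow> dim_col A = dim_row B \<Longrightarrow>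
    (A * B) $$ (i, j) = (\<Sum>k<dim_row B. A $$ (i, k) * B $$ (k, j))"
  by (simp add: scalar_prod_def atLeast0LessThan)

lemma index_mult3_mat_adj:
  assumes "A \<in> carrier_mat r c" "R \<in> carrier_mat c c" "x < r" "y < r"
  shows "(A * R * adj A) $$ (x, y) = (\<Sum>p<c. \<Sum>q<c. A $$ (x, p) * R $$ (p, q) * cnj (A $$ (y, q)))"
proof -
  have "(A * R * adj A) $$ (x, y) = (\<Sum>q<c. (\<Sum>p<c. A $$ (x, p) * R $$ (p, q)) * cnj (A $$ (y, q)))"
    using assms by (subst index_mult_mat_sum) (auto simp: index_mult_mat_sum simp del: index_mult_mat(1) intro!: sum.cong)
  also have "\<dots> = (\<Sum>p<c. \<Sum>q<c. A $$ (x, p) * R $$ (p, q) * cnj (A $$ (y, q)))"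
    unfolding sum_distrib_right by (rule sum.swap)
  finally show ?thesis .
qed

lemma adj_mult:
  assumes "A \<in> carrier_mat r c" "B \<in> carrier_mat c k"
  shows "adj (A * B) = adj B * adj A"
proof (rule eq_matI)
  fix x y assume "x < dim_row (adj B * adj A)" "y < dim_col (adj B * adj A)"
  then have "x < k" "y < r" using assms by simp_all
  then show "adj (A * B) $$ (x, y) = (adj B * adj A) $$ (x, y)"
    using assms by (simp add: index_mult_mat_sum mult.commute del: index_mult_mat(1))
qed (use assms in simp_all)

text \<open>The entrywise form of \<open>isometry_mat\<close>; it passes to blocks without
  manipulating matrix products.\<close>

definition orthonormal_cols :: "complex mat \<Rightarrow> bool" where
  "orthonormal_cols A \<longleftrightarrow> (\<forall>c<dim_col A. \<forall>c'<dim_col A.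
     (\<Sum>x<dim_row A. cnj (A $$ (x, c)) * A $$ (x, c')) = (if c = c' then 1 else 0))"

lemma isometry_mat_iff_orthonormal_cols: "isometry_mat A \<longleftrightarrow> orthonormal_cols A"
proof -
  have e: "(adj A * A) $$ (c, c') = (\<Sum>x<dim_row A. cnj (A $$ (x, c)) * A $$ (x, c'))"
    if "c < dim_col A" "c' < dim_col A" for c c'
    using that by (subst index_mult_mat_sum) simp_all
  show ?thesis
  proof
    assume "isometry_mat A"
    then have "adj A * A = 1\<^sub>m (dim_col A)" by (simp add: isometry_mat_def)
    then show "orthonormal_cols A" unfolding orthonormal_cols_def
      by (auto simp: e[symmetric] simp del: index_mult_mat(1))
  next
    assume "orthonormal_cols A"
    then show "isometry_mat A" unfolding isometry_mat_def orthonormal_cols_def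
      by (intro eq_matI) (simp_all add: e del: index_mult_mat(1))
  qed
qed

lemma isometry_mat_unitary:
  assumes "isometry_mat V" "dim_row V = dim_col V"
  shows "unitary_mat V"
proof -
  have "adj V * V = 1\<^sub>m (dim_col V)" using assms(1) unfolding isometry_mat_def .
  moreover have "adj V \<in> carrier_mat (dim_col V) (dim_col V)" "V \<in> carrier_mat (dim_col V) (dim_col V)"
    using assms(2) by (auto intro: carrier_matI)
  ultimately show ?thesis
    using mat_mult_left_right_inverse[of "adj V" "dim_col V" V] unfolding unitary_mat_def assms(2) by blast
qed

text \<open>Padding with zero rows would make a too wide isometry invertible.\<close>

lemma isometry_mat_dim_le:
  assumes iso: "isometry_mat V"
  shows "dim_col V \<le> dim_row V"
proof (rule ccontr)
  assume "\<not> dim_col V \<le> dim_row V"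
  then have lt: "dim_row V < dim_col V" by simp
  define P where "P = mat (dim_col V) (dim_col V) (\<lambda>(x, c). if x < dim_row V then V $$ (x, c) else 0)"
  have d: "dim_row P = dim_col V" "dim_col P = dim_col V" by (simp_all add: P_def)
  have "(\<Sum>x<dim_col V. cnj (P $$ (x, c)) * P $$ (x, c')) =
      (\<Sum>x<dim_row V. cnj (V $$ (x, c)) * V $$ (x, c'))" if "c < dim_col V" "c' < dim_col V" for c c'
    using lt that by (intro sum.mono_neutral_cong_right) (auto simp: P_def)
  then have "isometry_mat P"
    using iso by (simp add: isometry_mat_iff_orthonormal_cols orthonormal_cols_def d)
  then have u: "P * adj P = 1\<^sub>m (dim_col V)"
    using isometry_mat_unitary[of P] by (simp add: d unitary_mat_def)
  have "(P * adj P) $$ (dim_row V, dim_row V) = 0"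
    using lt by (subst index_mult_mat_sum) (auto simp: d, simp add: P_def)
  then show False using lt by (simp add: u)
qed

text \<open>Both \<open>V\<close> and its adjoint are isometries, so
  \<open>isometry_mat_dim_le\<close> applies in both directions.\<close>

lemma unitary_mat_dim:
  assumes "unitary_mat V"
  shows "dim_row V = dim_col V"
proof -
  have "adj (adj V) = V" by (intro eq_matI) simp_all
  then have "isometry_mat (adj V)" using assms by (simp add: unitary_mat_def isometry_mat_def)
  moreover have "isometry_mat V" using assms by (simp add: unitary_mat_def isometry_mat_def)
  ultimately show ?thesis using isometry_mat_dim_le[of V] isometry_mat_dim_le[of "adj V"] by simp
qed

lemma sum_lessThan_add: "(\<Sum>c<a + b. f c) = (\<Sum>c<a. f c) + (\<Sum>c<b. f (a + c :: nat) :: 'a :: comm_monoid_add)"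
  by (induction b) (simp_all add: add.assoc)

lemma dim_block_row [simp]:
  "dim_row (block_row r k F) = r" "dim_col (block_row r k F) = (\<Sum>i<k. dim_col (F i))"
  by (induction k) simp_all

lemma dim_block_col [simp]:
  "dim_col (block_col c k F) = c" "dim_row (block_col c k F) = (\<Sum>i<k. dim_row (F i))"
  by (induction k) simp_all

text \<open>A general \<open>g\<close> of two entries lets the lemma serve inner products of rows
  with the conjugate on either factor.\<close>

lemma sum_block_row:
  assumes "x < r" "y < r"
  shows "(\<Sum>c<dim_col (block_row r k F). g (block_row r k F $$ (x, c)) (block_row r k F $$ (y, c)))
    = (\<Sum>i<k. \<Sum>c<dim_col (F i). g (F i $$ (x, c)) (F i $$ (y, c)) :: complex)"
  using assms by (induction k) (simp_all add: sum_lessThan_add)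

lemma sum_block_col:
  assumes "x < r" "y < r"
  shows "(\<Sum>c<dim_row (block_col r k F). g (block_col r k F $$ (c, x)) (block_col r k F $$ (c, y)))
    = (\<Sum>i<k. \<Sum>c<dim_row (F i). g (F i $$ (c, x)) (F i $$ (c, y)) :: complex)"
  using assms by (induction k) (simp_all add: sum_lessThan_add)

text \<open>The columns of one block are consecutive columns of the block row, and
  \<open>dim_row (F i) = r\<close> makes them columns of full height.\<close>

lemma orthonormal_cols_block_rowD:
  assumes "orthonormal_cols (block_row r k F)" "i < k" "dim_row (F i) = r"
  shows "orthonormal_cols (F i)"
  using assms
proof (induction k)
  case (Suc k)
  let ?B = "block_row r k F" and ?S = "block_row r (Suc k) F"
  have o: "(\<Sum>x<r. cnj (?S $$ (x, c)) * ?S $$ (x, c')) = (if c = c' then 1 else 0)"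
    if "c < dim_col ?B + dim_col (F k)" "c' < dim_col ?B + dim_col (F k)" for c c'
    using Suc.prems(1) that by (simp add: orthonormal_cols_def)
  show ?case
  proof (cases "i = k")
    case True
    have "(\<Sum>x<r. cnj (F k $$ (x, c)) * F k $$ (x, c')) = (if c = c' then 1 else 0)"
      if "c < dim_col (F k)" "c' < dim_col (F k)" for c c'
      using o[of "dim_col ?B + c" "dim_col ?B + c'"] that by simp
    then show ?thesis using True Suc.prems(3) by (simp add: orthonormal_cols_def)
  next
    case False
    have "(\<Sum>x<r. cnj (?B $$ (x, c)) * ?B $$ (x, c')) = (if c = c' then 1 else 0)"
      if "c < dim_col ?B" "c' < dim_col ?B" for c c'
      using o[of c c'] that by simp
    then have "orthonormal_cols ?B" by (simp add: orthonormal_cols_def)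
    then show ?thesis using Suc False by simp
  qed
qed simp

section \<open>Linear maps between matrix families and their coefficients\<close>

lemma mm_linear_carrier:
  "mm_linear m dIn n dOut M \<Longrightarrow> \<rho> \<in> mm_carrier m dIn \<Longrightarrow> j < n \<Longrightarrow> M \<rho> j \<in> carrier_mat (dOut j) (dOut j)"
  by (auto simp: mm_linear_def mm_carrier_def)

lemma mm_linear_comb:
  assumes "mm_linear m dIn n dOut M" "\<rho> \<in> mm_carrier m dIn" "\<sigma> \<in> mm_carrier m dIn" "j < n"
  shows "M (\<lambda>i. a \<cdot>\<^sub>m \<rho> i + b \<cdot>\<^sub>m \<sigma> i) j = a \<cdot>\<^sub>m M \<rho> j + b \<cdot>\<^sub>m M \<sigma> j"
  using assms by (simp add: mm_linear_def)

lemma mm_linear_cong: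
  assumes lin: "mm_linear m dIn n dOut M"
    and \<rho>: "\<rho> \<in> mm_carrier m dIn" and eq: "\<And>i. i < m \<Longrightarrow> \<sigma> i = \<rho> i" and j: "j < n"
  shows "M \<rho> j = M \<sigma> j"
proof -
  \<comment> \<open>Adding \<open>0 \<cdot> cut\<close> erases the entries beyond \<open>m\<close>: a matrix sum takes the format of its right summand.\<close>
  define cut :: "nat \<Rightarrow> complex mat" where "cut i = (if i < m then 0\<^sub>m (dIn i) (dIn i) else 0\<^sub>m 0 0)" for i
  have cut: "cut \<in> mm_carrier m dIn" by (simp add: mm_carrier_def cut_def)
  have \<sigma>: "\<sigma> \<in> mm_carrier m dIn" using \<rho> eq by (simp add: mm_carrier_def)
  have same: "1 \<cdot>\<^sub>m \<rho> i + 0 \<cdot>\<^sub>m cut i = 1 \<cdot>\<^sub>m \<sigma> i + 0 \<cdot>\<^sub>m cut i" for i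
    by (cases "i < m") (simp_all add: eq cut_def mat_eq_iff)
  have L: "M (\<lambda>i. 1 \<cdot>\<^sub>m \<tau> i + 0 \<cdot>\<^sub>m cut i) j = M \<tau> j" if \<tau>: "\<tau> \<in> mm_carrier m dIn" for \<tau>
  proof -
    have c: "M \<tau> j \<in> carrier_mat (dOut j) (dOut j)" "M cut j \<in> carrier_mat (dOut j) (dOut j)"
      using mm_linear_carrier[OF lin] \<tau> cut j by blast+
    have "M (\<lambda>i. 1 \<cdot>\<^sub>m \<tau> i + 0 \<cdot>\<^sub>m cut i) j = 1 \<cdot>\<^sub>m M \<tau> j + 0 \<cdot>\<^sub>m M cut j"
      by (rule mm_linear_comb[OF lin \<tau> cut j])
    also have "\<dots> = M \<tau> j" using c by (intro eq_matI) auto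
    finally show ?thesis .
  qed
  show ?thesis using L[OF \<rho>] L[OF \<sigma>] by (simp only: same)
qed

text \<open>Induction on the index set from the two-term linearity. The carrier condition on
  \<open>F\<close> ranges over all \<open>i\<close>, so the families can be compared as
  functions.\<close>

lemma mm_linear_sum:
  fixes F :: "'a \<Rightarrow> nat \<Rightarrow> complex mat"
  assumes lin: "mm_linear m dIn n dOut M"
    and F: "\<And>a i. a \<in> A \<Longrightarrow> F a i \<in> carrier_mat (dIn i) (dIn i)"
    and j: "j < n" and fin: "finite A" and r: "r < dOut j" "s < dOut j"
  shows "M (\<lambda>i. mat (dIn i) (dIn i) (\<lambda>(x, y). \<Sum>a\<in>A. z a * F a i $$ (x, y))) j $$ (r, s)
    = (\<Sum>a\<in>A. z a * M (F a) j $$ (r, s))"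
  using fin F
proof (induction A)
  case empty
  \<comment> \<open>The empty sum is the zero family, written as a combination of two zero families
    with coefficients \<open>0\<close> so that linearity applies.\<close>
  let ?Z = "\<lambda>i. 0\<^sub>m (dIn i) (dIn i) :: complex mat"
  have Z: "?Z \<in> mm_carrier m dIn" by (simp add: mm_carrier_def)
  then have c: "M ?Z j \<in> carrier_mat (dOut j) (dOut j)"
    using mm_linear_carrier[OF lin] j by blast+
  have comb: "M (\<lambda>i. 0 \<cdot>\<^sub>m ?Z i + 0 \<cdot>\<^sub>m ?Z i) j = 0 \<cdot>\<^sub>m M ?Z j + 0 \<cdot>\<^sub>m M ?Z j"
    by (rule mm_linear_comb[OF lin Z Z j])
  have "(\<lambda>i. mat (dIn i) (dIn i) (\<lambda>(x, y). \<Sum>a\<in>{}. z a * F a i $$ (x, y))) = (\<lambda>i. 0 \<cdot>\<^sub>m ?Z i + 0 \<cdot>\<^sub>m ?Z i)"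
    by (intro ext eq_matI) auto
  then show ?case using c r by (simp only: comb) simp
next
  case (insert b A)
  let ?G = "\<lambda>i. mat (dIn i) (dIn i) (\<lambda>(x, y). \<Sum>a\<in>A. z a * F a i $$ (x, y))"
  have G: "?G \<in> mm_carrier m dIn" and Fb: "F b \<in> mm_carrier m dIn"
    using insert.prems by (auto simp: mm_carrier_def)
  then have c: "M ?G j \<in> carrier_mat (dOut j) (dOut j)" "M (F b) j \<in> carrier_mat (dOut j) (dOut j)"
    using mm_linear_carrier[OF lin] j by blast+
  have comb: "M (\<lambda>i. z b \<cdot>\<^sub>m F b i + 1 \<cdot>\<^sub>m ?G i) j = z b \<cdot>\<^sub>m M (F b) j + 1 \<cdot>\<^sub>m M ?G j"
    by (rule mm_linear_comb[OF lin Fb G j])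
  have "(\<lambda>i. mat (dIn i) (dIn i) (\<lambda>(x, y). \<Sum>a\<in>insert b A. z a * F a i $$ (x, y)))
      = (\<lambda>i. z b \<cdot>\<^sub>m F b i + 1 \<cdot>\<^sub>m ?G i)"
  proof (intro ext eq_matI)
    fix i x y
    assume "x < dim_row (z b \<cdot>\<^sub>m F b i + 1 \<cdot>\<^sub>m ?G i)" "y < dim_col (z b \<cdot>\<^sub>m F b i + 1 \<cdot>\<^sub>m ?G i)"
    then have "x < dIn i" "y < dIn i" by simp_all
    moreover have "F b i \<in> carrier_mat (dIn i) (dIn i)" using insert.prems by simp
    ultimately show "mat (dIn i) (dIn i) (\<lambda>(x, y). \<Sum>a\<in>insert b A. z a * F a i $$ (x, y)) $$ (x, y)
        = (z b \<cdot>\<^sub>m F b i + 1 \<cdot>\<^sub>m ?G i) $$ (x, y)"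
      using insert.hyps by simp
  qed simp_all
  then have split: "M (\<lambda>i. mat (dIn i) (dIn i) (\<lambda>(x, y). \<Sum>a\<in>insert b A. z a * F a i $$ (x, y))) j $$ (r, s)
      = z b * M (F b) j $$ (r, s) + M ?G j $$ (r, s)"
    using c r by (simp only: comb) simp
  have IH: "M ?G j $$ (r, s) = (\<Sum>a\<in>A. z a * M (F a) j $$ (r, s))" using insert by blast
  show ?case unfolding split IH using insert.hyps by simp
qed

definition unit_mat :: "nat \<Rightarrow> nat \<Rightarrow> nat \<Rightarrow> complex mat" where
  "unit_mat D x y = mat D D (\<lambda>(a, b). if a = x \<and> b = y then 1 else 0)"

text \<open>For fixed \<open>j\<close> and \<open>i\<close> these are the entries of the Choi matrix
  of the component of \<open>M\<close> from block \<open>j\<close> to block \<open>i\<close>, in the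
  argument order of \<open>C\<close> in \<open>inverse_coeffs\<close>.\<close>

definition mm_coeff where
  "mm_coeff dIn M j i x y r s = M (mm_single dIn j (unit_mat (dIn j) x y)) i $$ (r, s)"

lemma mm_linear_index:
  assumes lin: "mm_linear n dIn m dOut N" and \<rho>: "\<rho> \<in> mm_carrier n dIn"
    and i: "i < m" and r: "r < dOut i" "s < dOut i"
  shows "N \<rho> i $$ (r, s) = (\<Sum>j<n. \<Sum>x<dIn j. \<Sum>y<dIn j. \<rho> j $$ (x, y) * mm_coeff dIn N j i x y r s)"
proof -
  define A where "A = Sigma {..<n} (\<lambda>j. {..<dIn j} \<times> {..<dIn j})"
  define F where "F = (\<lambda>(j, x, y). mm_single dIn j (unit_mat (dIn j) x y))"
  let ?z = "\<lambda>(j, x, y). \<rho> j $$ (x, y)"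
  let ?G = "\<lambda>j. mat (dIn j) (dIn j) (\<lambda>(x, y). \<Sum>a\<in>A. ?z a * F a j $$ (x, y))"
  have "?G j = \<rho> j" if j: "j < n" for j
  proof (rule eq_matI)
    have c: "\<rho> j \<in> carrier_mat (dIn j) (dIn j)" using \<rho> j by (simp add: mm_carrier_def)
    show "dim_row (?G j) = dim_row (\<rho> j)" "dim_col (?G j) = dim_col (\<rho> j)" using c by auto
    fix x y assume "x < dim_row (\<rho> j)" "y < dim_col (\<rho> j)"
    then have xy: "x < dIn j" "y < dIn j" using c by auto
    have "(\<Sum>a\<in>A. ?z a * F a j $$ (x, y)) = (\<Sum>a\<in>A. if a = (j, x, y) then \<rho> j $$ (x, y) else 0)"
      using xy by (intro sum.cong refl) (auto simp: F_def mm_single_def unit_mat_def split: if_splits)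
    also have "\<dots> = \<rho> j $$ (x, y)" using xy j by (simp add: A_def)
    finally show "?G j $$ (x, y) = \<rho> j $$ (x, y)" using xy by simp
  qed
  \<comment> \<open>\<open>?G\<close> and \<open>\<rho>\<close> are known to agree only on the
    blocks below \<open>n\<close>, which \<open>mm_linear_cong\<close> shows to be enough.\<close>
  then have "N \<rho> i $$ (r, s) = N ?G i $$ (r, s)"
    using mm_linear_cong[OF lin \<rho> _ i, of ?G] by simp
  also have "\<dots> = (\<Sum>a\<in>A. ?z a * N (F a) i $$ (r, s))"
    by (rule mm_linear_sum[OF lin _ i _ r]) (auto simp: A_def F_def mm_single_def unit_mat_def)
  also have "\<dots> = (\<Sum>j<n. \<Sum>x<dIn j. \<Sum>y<dIn j. \<rho> j $$ (x, y) * mm_coeff dIn N j i x y r s)"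
    unfolding A_def sum.cartesian_product
    by (subst sum.Sigma) (auto simp: F_def mm_coeff_def case_prod_unfold)
  finally show ?thesis .
qed

definition outer :: "nat \<Rightarrow> (nat \<Rightarrow> complex) \<Rightarrow> (nat \<Rightarrow> complex) \<Rightarrow> complex mat" where
  "outer D u v = mat D D (\<lambda>(x, y). u x * cnj (v y))"

lemma outer_carrier [simp]: "outer D u v \<in> carrier_mat D D"
  by (simp add: outer_def)

lemma mm_single_carrier: "X \<in> carrier_mat (dIn j) (dIn j) \<Longrightarrow> mm_single dIn j X \<in> mm_carrier n dIn"
  by (simp add: mm_carrier_def mm_single_def)

text \<open>This identifies \<open>sform\<close> with a matrix entry of the image of a rank-one
  operator placed in one block.\<close>

lemma mm_linear_outer:
  assumes lin: "mm_linear n dIn m dOut N" and "j < n" "i < m" "r < dOut i" "s < dOut i"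
  shows "N (mm_single dIn j (outer (dIn j) u v)) i $$ (r, s) =
     sform (dIn j) (\<lambda>x y. mm_coeff dIn N j i x y r s) u v"
proof -
  have "N (mm_single dIn j (outer (dIn j) u v)) i $$ (r, s) =
    (\<Sum>j'<n. if j' = j then sform (dIn j) (\<lambda>x y. mm_coeff dIn N j i x y r s) u v else 0)"
    unfolding mm_linear_index[OF lin mm_single_carrier[of _ dIn j, OF outer_carrier] assms(3-5)]
    by (intro sum.cong refl) (auto simp: mm_single_def outer_def sform_def)
  then show ?thesis using assms by simp
qed

section \<open>Recovering the inverse from a complete family of columns\<close>

context inverse_coeffs_basis
begin

text \<open>Expanding \<rho> in the operators |w\<rangle>\<langle>w'| leaves, by
  \<open>\<nu>_w\<close>, only the pairs \<open>(i, r, a)\<close> and \<open>(i, s, a)\<close>; the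
  remaining sum over \<open>a\<close> is the partial trace over \<open>E_ji\<close>.\<close>

lemma reconstruct:
  assumes ij: "i < m" "j < n" and rs: "r < K i" "s < K i"
    and res: "\<And>x y. x < D j \<Longrightarrow> y < D j \<Longrightarrow>
      (\<Sum>i<m. \<Sum>p<K i. \<Sum>a<E j i. w j i p a x * cnj (w j i p a y)) = (if x = y then 1 else 0)"
  shows "(\<Sum>x<D j. \<Sum>y<D j. \<rho> x y * C j i x y r s) =
    (\<Sum>a<E j i. \<Sum>x<D j. \<Sum>y<D j. cnj (w j i r a x) * \<rho> x y * w j i s a y)"
proof -
  define P where "P = Sigma {..<m} (\<lambda>i. {..<K i} \<times> {..<E j i})"
  define W where "W = (\<lambda>(i, p, a). w j i p a)"
  define f where "f = (\<lambda>\<alpha> \<beta>. \<Sum>x<D j. \<Sum>y<D j. cnj (W \<alpha> x) * \<rho> x y * W \<beta> y)"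
  have sumP: "(\<Sum>\<alpha>\<in>P. h \<alpha>) = (\<Sum>i<m. \<Sum>p<K i. \<Sum>a<E j i. h (i, p, a))" for h :: "_ \<Rightarrow> complex"
    unfolding P_def sum.cartesian_product by (subst sum.Sigma) (auto simp: case_prod_unfold)
  have finP: "finite P" by (auto simp: P_def)
  have "(\<Sum>x<D j. \<Sum>y<D j. \<rho> x y * C j i x y r s) = (\<Sum>\<alpha>\<in>P. \<Sum>\<beta>\<in>P. f \<alpha> \<beta> * \<nu> j i r s (W \<alpha>) (W \<beta>))"
    unfolding f_def by (rule sform_resolution) (simp add: sumP W_def res)
  \<comment> \<open>For given \<open>\<alpha> = (i1, p, a)\<close> the only possible partner
    \<open>\<beta>\<close> is \<open>(i, s, a)\<close>.\<close>
  also have "\<dots> = (\<Sum>\<alpha>\<in>P. if fst \<alpha> = i \<and> fst (snd \<alpha>) = r then f \<alpha> (i, s, snd (snd \<alpha>)) else 0)"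
  proof (rule sum.cong[OF refl])
    fix \<alpha> assume "\<alpha> \<in> P"
    then obtain i1 p a where \<alpha>: "\<alpha> = (i1, p, a)" "i1 < m" "p < K i1" "a < E j i1"
      by (auto simp: P_def)
    have "(\<Sum>\<beta>\<in>P. f \<alpha> \<beta> * \<nu> j i r s (W \<alpha>) (W \<beta>)) =
        (\<Sum>\<beta>\<in>P. if \<beta> = (i, s, a) then (if i1 = i \<and> p = r then f \<alpha> \<beta> else 0) else 0)"
    proof (rule sum.cong[OF refl])
      fix \<beta> assume "\<beta> \<in> P"
      then obtain i2 q b where \<beta>: "\<beta> = (i2, q, b)" "i2 < m" "q < K i2" "b < E j i2"
        by (auto simp: P_def)
      have "\<nu> j i r s (W \<alpha>) (W \<beta>) = (if i1 = i \<and> i2 = i \<and> p = r \<and> q = s \<and> a = b then 1 else 0)"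
        unfolding \<alpha>(1) \<beta>(1) W_def using \<nu>_w ij rs \<alpha> \<beta> by simp
      then show "f \<alpha> \<beta> * \<nu> j i r s (W \<alpha>) (W \<beta>) =
          (if \<beta> = (i, s, a) then (if i1 = i \<and> p = r then f \<alpha> \<beta> else 0) else 0)"
        using \<beta>(1) by auto
    qed
    also have "\<dots> = (if (i, s, a) \<in> P then (if i1 = i \<and> p = r then f \<alpha> (i, s, a) else 0) else 0)"
      by (simp add: finP)
    also have "\<dots> = (if fst \<alpha> = i \<and> fst (snd \<alpha>) = r then f \<alpha> (i, s, snd (snd \<alpha>)) else 0)"
      using \<alpha> ij rs by (auto simp: P_def)
    finally show "(\<Sum>\<beta>\<in>P. f \<alpha> \<beta> * \<nu> j i r s (W \<alpha>) (W \<beta>)) =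
        (if fst \<alpha> = i \<and> fst (snd \<alpha>) = r then f \<alpha> (i, s, snd (snd \<alpha>)) else 0)" .
  qed
  also have "\<dots> = (\<Sum>i1<m. \<Sum>p<K i1. if i1 = i \<and> p = r then (\<Sum>a<E j i. f (i, r, a) (i, s, a)) else 0)"
    unfolding sumP by (intro sum.cong refl) auto
  also have "\<dots> = (\<Sum>i1<m. if i1 = i then (\<Sum>p<K i. if p = r then (\<Sum>a<E j i. f (i, r, a) (i, s, a)) else 0) else 0)"
    by (intro sum.cong refl) auto
  also have "\<dots> = (\<Sum>a<E j i. f (i, r, a) (i, s, a))"
    using ij rs by simp
  finally show ?thesis by (simp add: f_def W_def)
qed

end

section \<open>Complete positivity and trace preservation in coefficients\<close>

lemma sum_prod_index: "(\<Sum>a<p * q. f a) = (\<Sum>x<p. \<Sum>y<q. f (x * q + y) :: 'a :: comm_monoid_add)" for p q :: nat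
proof (induction p)
  case (Suc p)
  have "Suc p * q = p * q + q" by simp
  then show ?case by (simp only: sum_lessThan_add Suc sum.lessThan_Suc)
qed simp

lemma prod_index_less: "x < p \<Longrightarrow> y < q \<Longrightarrow> x * q + y < p * q" for p q :: nat
proof -
  assume "x < p" "y < q"
  then have "x * q + y < Suc x * q" "Suc x * q \<le> p * q" by (simp, intro mult_le_mono1) simp
  then show ?thesis by (rule less_le_trans)
qed

lemma index_pair:
  fixes a p q :: nat
  assumes "a < p * q"
  shows "a div q < p" "a mod q < q" "0 < q"
proof -
  show q: "0 < q" using assms by (cases q) simp_all
  show "a div q < p" using assms by (rule less_mult_imp_div_less)
  show "a mod q < q" using q by simp
qed

lemma quadratic_form_sum:
  assumes "A \<in> carrier_mat D D" "v \<in> carrier_vec D"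
  shows "conjugate v \<bullet> (A *\<^sub>v v) = (\<Sum>x<D. \<Sum>y<D. cnj (v $ x) * A $$ (x, y) * v $ y)"
proof -
  have "conjugate v \<bullet> (A *\<^sub>v v) = (\<Sum>x<D. cnj (v $ x) * (\<Sum>y<D. A $$ (x, y) * v $ y))"
    using assms unfolding scalar_prod_def atLeast0LessThan
    by (intro sum.cong) (auto simp: scalar_prod_def atLeast0LessThan intro!: sum.cong)
  then show ?thesis by (simp add: sum_distrib_left mult.assoc)
qed

lemma psd_outer: "psd_mat D (outer D u u)"
proof -
  have "conjugate v \<bullet> (outer D u u *\<^sub>v v) = (\<Sum>x<D. cnj (v $ x) * u x) * cnj (\<Sum>x<D. cnj (v $ x) * u x)"
    if "v \<in> carrier_vec D" for v
    unfolding quadratic_form_sum[OF outer_carrier that] cnj_sum sum_product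
    by (intro sum.cong refl) (simp add: outer_def mult_ac)
  then show ?thesis
    unfolding psd_mat_def by (simp add: complex_mult_cnj del: cnj_sum)
qed

lemma psd_zero: "psd_mat D (0\<^sub>m D D)"
  by (simp add: psd_mat_def quadratic_form_sum[OF zero_carrier_mat])

text \<open>With an ancilla of dimension \<open>K = dOut i\<close>, the map is applied to the
  rank-one positive operator of the vector with components \<open>\<psi> l x\<close>. Its output,
  tested on an unnormalised maximally entangled vector, gives the Choi form.\<close>

lemma choi_form_coeff_nonneg:
  assumes lin: "mm_linear n dIn m dOut N" and cp: "completely_positive n dIn m dOut N"
    and ij: "i < m" "j < n"
  shows "Im (choi_form (dIn j) (dOut i) (mm_coeff dIn N j i) \<psi> \<psi>) = 0 \<and>
    Re (choi_form (dIn j) (dOut i) (mm_coeff dIn N j i) \<psi> \<psi>) \<ge> 0"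
proof -
  define K where "K = dOut i"
  define g where "g = (\<lambda>q. \<psi> (q mod K) (q div K))"
  define R where "R = mm_single (\<lambda>j. dIn j * K) j (outer (dIn j * K) g g)"
  define Z where "Z = tensor_id_map dIn dOut K N R i"
  \<comment> \<open>The vector \<Sum> \<open>e_x \<otimes> e_x\<close>: it pairs each output index
    with the equal ancilla index.\<close>
  define v :: "complex vec" where "v = vec (K * K) (\<lambda>a. if a div K = a mod K then 1 else 0)"
  have "R \<in> mm_carrier n (\<lambda>j. dIn j * K)" unfolding R_def by (rule mm_single_carrier) simp
  moreover have "mm_psd n (\<lambda>j. dIn j * K) R"
    by (simp add: mm_psd_def R_def mm_single_def psd_outer psd_zero)
  ultimately have "mm_psd m (\<lambda>i. dOut i * K) (tensor_id_map dIn dOut K N R)"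
    using cp unfolding completely_positive_def by blast
  then have psd: "psd_mat (K * K) Z" using ij by (simp add: mm_psd_def Z_def K_def)
  have v: "v \<in> carrier_vec (K * K)" by (simp add: v_def)
  have Zc: "Z \<in> carrier_mat (K * K) (K * K)" using psd by (simp add: psd_mat_def)
  have Z: "Z $$ (a, b) = sform (dIn j) (\<lambda>x y. mm_coeff dIn N j i x y (a div K) (b div K)) (\<psi> (a mod K)) (\<psi> (b mod K))"
    if ab: "a < K * K" "b < K * K" for a b
  proof -
    note ia = index_pair[OF ab(1)] and ib = index_pair[OF ab(2)]
    have "(\<lambda>j'. mat (dIn j') (dIn j') (\<lambda>(p, q). R j' $$ (p * K + a mod K, q * K + b mod K)))
        = mm_single dIn j (outer (dIn j) (\<psi> (a mod K)) (\<psi> (b mod K)))"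
      using ia ib by (intro ext eq_matI) (auto simp: R_def mm_single_def outer_def g_def prod_index_less)
    then have "Z $$ (a, b) = N (mm_single dIn j (outer (dIn j) (\<psi> (a mod K)) (\<psi> (b mod K)))) i $$ (a div K, b div K)"
      using ab by (simp add: Z_def tensor_id_map_def K_def)
    then show ?thesis using mm_linear_outer[OF lin ij(2,1)] ia ib by (simp add: K_def)
  qed
  have vi: "v $ (x * K + y) = (if y = x then 1 else 0)" if "x < K" "y < K" for x y
    using that by (auto simp: v_def prod_index_less)
  have "conjugate v \<bullet> (Z *\<^sub>v v) = (\<Sum>x<K. \<Sum>y<K. \<Sum>x'<K. \<Sum>y'<K.
      cnj (v $ (x * K + y)) * Z $$ (x * K + y, x' * K + y') * v $ (x' * K + y'))"
    unfolding quadratic_form_sum[OF Zc v] sum_prod_index ..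
  also have "\<dots> = (\<Sum>x<K. \<Sum>y<K. \<Sum>x'<K. \<Sum>y'<K. if y = x then (if y' = x' then Z $$ (x * K + x, x' * K + x') else 0) else 0)"
    by (intro sum.cong refl) (simp add: vi)
  also have "\<dots> = (\<Sum>x<K. \<Sum>y<K. if y = x then (\<Sum>x'<K. \<Sum>y'<K. if y' = x' then Z $$ (x * K + x, x' * K + x') else 0) else 0)"
    by (intro sum.cong refl) auto
  also have "\<dots> = (\<Sum>x<K. \<Sum>x'<K. Z $$ (x * K + x, x' * K + x'))"
    by simp
  also have "\<dots> = choi_form (dIn j) K (mm_coeff dIn N j i) \<psi> \<psi>"
    unfolding choi_form_def by (intro sum.cong refl) (simp add: Z prod_index_less)
  finally have eq: "conjugate v \<bullet> (Z *\<^sub>v v) = choi_form (dIn j) K (mm_coeff dIn N j i) \<psi> \<psi>" .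
  have "Im (conjugate v \<bullet> (Z *\<^sub>v v)) = 0 \<and> Re (conjugate v \<bullet> (Z *\<^sub>v v)) \<ge> 0"
    using psd v unfolding psd_mat_def by blast
  then show ?thesis unfolding eq unfolding K_def .
qed

text \<open>Trace preservation at the operator |u\<rangle>\<langle>v| in block \<open>j\<close>,
  whose trace is the inner product on the right.\<close>

lemma trace_pres_coeff:
  assumes lin: "mm_linear n dIn m dOut N" and tp: "trace_preserving n dIn m N" and j: "j < n"
  shows "(\<Sum>i<m. \<Sum>r<dOut i. sform (dIn j) (\<lambda>x y. mm_coeff dIn N j i x y r r) u v) = (\<Sum>x<dIn j. u x * cnj (v x))"
proof -
  let ?X = "mm_single dIn j (outer (dIn j) u v)"
  have X: "?X \<in> mm_carrier n dIn" by (rule mm_single_carrier) simp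
  have "(\<Sum>i<m. \<Sum>r<dOut i. sform (dIn j) (\<lambda>x y. mm_coeff dIn N j i x y r r) u v) = mm_trace m (N ?X)"
    unfolding mm_trace_def
  proof (rule sum.cong[OF refl])
    fix i assume i: "i \<in> {..<m}"
    then have "dim_row (N ?X i) = dOut i" using mm_linear_carrier[OF lin X] by auto
    then show "(\<Sum>r<dOut i. sform (dIn j) (\<lambda>x y. mm_coeff dIn N j i x y r r) u v) = mtrace (N ?X i)"
      unfolding mtrace_def using i j by (intro sum.cong) (simp_all add: mm_linear_outer[OF lin])
  qed
  also have "\<dots> = mm_trace n ?X" using tp X by (simp add: trace_preserving_def)
  also have "\<dots> = (\<Sum>j'<n. if j' = j then (\<Sum>x<dIn j. u x * cnj (v x)) else 0)"
    unfolding mm_trace_def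
    by (intro sum.cong refl) (auto simp: mtrace_def mm_single_def outer_def intro!: sum.cong)
  finally show ?thesis using j by simp
qed

section \<open>The channel applied to one half of the entangled state\<close>

lemma dim_tensor_mat [simp]:
  "dim_row (tensor_mat A B) = dim_row A * dim_row B" "dim_col (tensor_mat A B) = dim_col A * dim_col B"
  by (simp_all add: tensor_mat_def)

lemma tensor_one_carrier:
  "\<kappa> \<in> carrier_mat e e \<Longrightarrow> tensor_mat (1\<^sub>m p) \<kappa> \<in> carrier_mat (p * e) (p * e)"
  by (auto intro!: carrier_matI)

lemma index_mult_tensor_one_left:
  assumes w: "\<omega> \<in> carrier_mat d d" and B: "B \<in> carrier_mat (p * d) c" and a: "a < p * d" and b: "b < c"
  shows "(tensor_mat (1\<^sub>m p) \<omega> * B) $$ (a, b) = (\<Sum>h<d. \<omega> $$ (a mod d, h) * B $$ ((a div d) * d + h, b))"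
proof -
  note ia = index_pair[OF a]
  have "(tensor_mat (1\<^sub>m p) \<omega> * B) $$ (a, b) =
      (\<Sum>x<p. \<Sum>h<d. tensor_mat (1\<^sub>m p) \<omega> $$ (a, x * d + h) * B $$ (x * d + h, b))"
    using assms by (subst index_mult_mat_sum) (auto simp: sum_prod_index)
  also have "\<dots> = (\<Sum>x<p. if x = a div d then (\<Sum>h<d. \<omega> $$ (a mod d, h) * B $$ ((a div d) * d + h, b)) else 0)"
    using w a ia by (intro sum.cong refl) (auto simp: tensor_mat_def prod_index_less intro!: sum.cong sum.neutral)
  also have "\<dots> = (\<Sum>h<d. \<omega> $$ (a mod d, h) * B $$ ((a div d) * d + h, b))"
    using ia by simp
  finally show ?thesis .
qed

lemma index_mult_tensor_one_right:
  assumes k: "\<kappa> \<in> carrier_mat e e" and B: "B \<in> carrier_mat r (p * e)" and x: "x < r" and b: "b < p * e"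
  shows "(B * tensor_mat (1\<^sub>m p) \<kappa>) $$ (x, b) = (\<Sum>k<e. B $$ (x, (b div e) * e + k) * \<kappa> $$ (k, b mod e))"
proof -
  note ib = index_pair[OF b]
  have "(B * tensor_mat (1\<^sub>m p) \<kappa>) $$ (x, b) =
      (\<Sum>q<p. \<Sum>k<e. B $$ (x, q * e + k) * tensor_mat (1\<^sub>m p) \<kappa> $$ (q * e + k, b))"
    using assms by (subst index_mult_mat_sum) (auto simp: sum_prod_index)
  also have "\<dots> = (\<Sum>q<p. if q = b div e then (\<Sum>k<e. B $$ (x, (b div e) * e + k) * \<kappa> $$ (k, b mod e)) else 0)"
    using k b ib by (intro sum.cong refl) (auto simp: tensor_mat_def prod_index_less intro!: sum.cong sum.neutral)
  also have "\<dots> = (\<Sum>k<e. B $$ (x, (b div e) * e + k) * \<kappa> $$ (k, b mod e))"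
    using ib by simp
  finally show ?thesis .
qed

text \<open>The operator \<open>T_ij\<close>; its column \<open>p * ne + k\<close> is the Kraus
  operator with index \<open>k\<close> applied to \<open>e_p\<close>.\<close>

definition transfer_op :: "nat \<Rightarrow> nat \<Rightarrow> nat \<Rightarrow> nat \<Rightarrow> complex mat \<Rightarrow> complex mat \<Rightarrow> complex mat" where
  "transfer_op nx ny d ne \<omega> \<tau> = tensor_mat (1\<^sub>m ny) \<omega> * tilde_op nx ny d ne \<tau>"

lemma transfer_op_carrier:
  "\<omega> \<in> carrier_mat d d \<Longrightarrow> transfer_op nx ny d ne \<omega> \<tau> \<in> carrier_mat (ny * d) (nx * ne)"
  by (auto simp: transfer_op_def tensor_mat_def tilde_op_def intro!: carrier_matI)

lemma index_transfer_op:
  assumes w: "\<omega> \<in> carrier_mat d d" and a: "a < ny * d" and p: "p < nx" and k: "k < ne"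
  shows "transfer_op nx ny d ne \<omega> \<tau> $$ (a, p * ne + k) =
    (\<Sum>h<d. \<omega> $$ (a mod d, h) * \<tau> $$ ((a div d) * ne + k, p * d + h))"
proof -
  note ia = index_pair[OF a]
  have "transfer_op nx ny d ne \<omega> \<tau> $$ (a, p * ne + k) =
    (\<Sum>h<d. \<omega> $$ (a mod d, h) * tilde_op nx ny d ne \<tau> $$ ((a div d) * d + h, p * ne + k))"
    unfolding transfer_op_def
    by (rule index_mult_tensor_one_left[OF w _ a]) (auto simp: tilde_op_def prod_index_less p k)
  also have "\<dots> = (\<Sum>h<d. \<omega> $$ (a mod d, h) * \<tau> $$ ((a div d) * ne + k, p * d + h))"
    using ia p k by (intro sum.cong refl) (simp add: tilde_op_def prod_index_less)
  finally show ?thesis .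
qed

lemma index_tensor_W_state:
  assumes A: "A \<in> carrier_mat nx nx" and "x < nx" "x' < nx" "h < d" "h' < d" "g < d" "g' < d"
  shows "tensor_mat A (W_state d \<omega>) $$ ((x * d + h) * d + g, (x' * d + h') * d + g') =
    A $$ (x, x') * (\<omega> $$ (g, h) * cnj (\<omega> $$ (g', h')))"
proof -
  \<comment> \<open>The two bracketings of \<open>X \<otimes> H \<otimes> H\<close> number the basis
    in the same way: \<open>tensor_mat\<close> groups the two copies of \<open>H\<close>, while
    \<open>tensor_id_map\<close> splits off the last one.\<close>
  have e: "(x * d + h) * d + g = x * (d * d) + (h * d + g)" for x h g :: nat
    by (simp add: algebra_simps)
  have l: "h * d + g < d * d" "h' * d + g' < d * d" using assms by (simp_all add: prod_index_less)
  have "x * (d * d) + (h * d + g) < nx * (d * d)" "x' * (d * d) + (h' * d + g') < nx * (d * d)"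
    using l assms by (blast intro: prod_index_less)+
  then show ?thesis
    unfolding e using l assms by (simp add: tensor_mat_def W_state_def w_vec_def)
qed

text \<open>A Kraus decomposition: the vectors \<open>u k\<close> are the images of \<xi> under the
  Kraus operators of \<rho> \<mapsto> (M \<otimes> id)(\<rho> \<otimes> W).\<close>

lemma tensor_id_map_dilation:
  fixes \<xi> :: "nat \<Rightarrow> complex"
  assumes dil: "minimal_dilation m dx n dy d de M \<tau>" and w: "\<omega> \<in> carrier_mat d d"
    and i: "i < m" and j: "j < n"
  defines "u \<equiv> \<lambda>k x. \<Sum>p<dx i. \<xi> p * transfer_op (dx i) (dy j) d (de j i) \<omega> (\<tau> i j) $$ (x, p * de j i + k)"
  shows "tensor_id_map (\<lambda>i. dx i * d) dy d M
      (\<lambda>i'. tensor_mat (mm_single dx i (outer (dx i) \<xi> \<xi>) i') (W_state d \<omega>)) j =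
    mat (dy j * d) (dy j * d) (\<lambda>(a, b). \<Sum>k<de j i. u k a * cnj (u k b))"
    (is "tensor_id_map _ _ _ _ ?\<rho> _ = ?R")
proof (rule eq_matI)
  let ?e = "de j i"
  show "dim_row (tensor_id_map (\<lambda>i. dx i * d) dy d M ?\<rho> j) = dim_row ?R"
    "dim_col (tensor_id_map (\<lambda>i. dx i * d) dy d M ?\<rho> j) = dim_col ?R"
    by (simp_all add: tensor_id_map_def)
  fix a b assume "a < dim_row ?R" "b < dim_col ?R"
  then have ab: "a < dy j * d" "b < dy j * d" by simp_all
  note ia = index_pair[OF ab(1)] and ib = index_pair[OF ab(2)]
  have \<tau>: "\<tau> i j \<in> carrier_mat (dy j * ?e) (dx i * d)"
    using dil i j by (simp add: minimal_dilation_def)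
  \<comment> \<open>The slice of \<xi> \<otimes> \<open>w_vec d \<omega>\<close> at the basis index
    \<open>a mod d\<close> of the second copy of \<open>H\<close>.\<close>
  define g where "g a P = \<xi> (P div d) * \<omega> $$ (a mod d, P mod d)" for a P
  have u: "u k a = (\<Sum>P<dx i * d. \<tau> i j $$ ((a div d) * ?e + k, P) * g a P)"
    if "k < ?e" "a < dy j * d" for k a
    unfolding u_def sum_prod_index g_def
    using that by (intro sum.cong refl) (simp add: index_transfer_op[OF w] sum_distrib_left mult_ac)
  \<comment> \<open>Fixing both indices in the second copy of \<open>H\<close> leaves a rank-one
    operator in block \<open>i\<close>, to which the dilation formula applies.\<close>
  have fam: "(\<lambda>i'. mat (dx i' * d) (dx i' * d) (\<lambda>(p, q). ?\<rho> i' $$ (p * d + a mod d, q * d + b mod d)))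
      = mm_single (\<lambda>i. dx i * d) i (outer (dx i * d) (g a) (g b))"
  proof (intro ext eq_matI)
    fix i' p q
    assume "p < dim_row (mm_single (\<lambda>i. dx i * d) i (outer (dx i * d) (g a) (g b)) i')"
      "q < dim_col (mm_single (\<lambda>i. dx i * d) i (outer (dx i * d) (g a) (g b)) i')"
    then have pq: "p < dx i' * d" "q < dx i' * d"
      by (auto simp: mm_single_def outer_def split: if_splits)
    note ip = index_pair[OF pq(1)] and iq = index_pair[OF pq(2)]
    have "?\<rho> i' $$ (p * d + a mod d, q * d + b mod d) =
        mm_single dx i (outer (dx i) \<xi> \<xi>) i' $$ (p div d, q div d) * (\<omega> $$ (a mod d, p mod d) * cnj (\<omega> $$ (b mod d, q mod d)))"
      using index_tensor_W_state[of "mm_single dx i (outer (dx i) \<xi> \<xi>) i'" "dx i'" "p div d" "q div d" "p mod d" d "q mod d" "a mod d" "b mod d" \<omega>]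
        ip iq ia ib by (simp add: mm_single_def)
    then show "mat (dx i' * d) (dx i' * d) (\<lambda>(p, q). ?\<rho> i' $$ (p * d + a mod d, q * d + b mod d)) $$ (p, q)
        = mm_single (\<lambda>i. dx i * d) i (outer (dx i * d) (g a) (g b)) i' $$ (p, q)"
      using pq ip iq by (cases "i' = i") (auto simp: mm_single_def outer_def g_def mult_ac)
  qed (simp_all add: mm_single_def outer_def)
  have "tensor_id_map (\<lambda>i. dx i * d) dy d M ?\<rho> j $$ (a, b) =
      M (mm_single (\<lambda>i. dx i * d) i (outer (dx i * d) (g a) (g b))) j $$ (a div d, b div d)"
    using ab fam by (simp add: tensor_id_map_def)
  also have "\<dots> = ptrace2 (dy j) ?e (\<tau> i j * outer (dx i * d) (g a) (g b) * adj (\<tau> i j)) $$ (a div d, b div d)"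
    using dil i j by (simp add: minimal_dilation_def)
  also have "\<dots> = (\<Sum>k<?e. (\<tau> i j * outer (dx i * d) (g a) (g b) * adj (\<tau> i j)) $$ (a div d * ?e + k, b div d * ?e + k))"
    using ia ib by (simp add: ptrace2_def)
  also have "\<dots> = (\<Sum>k<?e. u k a * cnj (u k b))"
  proof (rule sum.cong[OF refl])
    fix k assume "k \<in> {..<?e}"
    then have k: "k < ?e" by simp
    have "(\<tau> i j * outer (dx i * d) (g a) (g b) * adj (\<tau> i j)) $$ (a div d * ?e + k, b div d * ?e + k)
      = (\<Sum>p<dx i * d. \<Sum>q<dx i * d. \<tau> i j $$ (a div d * ?e + k, p) * (g a p * cnj (g b q)) * cnj (\<tau> i j $$ (b div d * ?e + k, q)))"
      using index_mult3_mat_adj[OF \<tau> outer_carrier prod_index_less[OF ia(1) k] prod_index_less[OF ib(1) k]]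
      by (simp add: outer_def)
    also have "\<dots> = u k a * cnj (u k b)"
      unfolding u[OF k ab(1)] u[OF k ab(2)] cnj_sum sum_product
      by (intro sum.cong refl) (simp add: mult_ac)
    finally show "(\<tau> i j * outer (dx i * d) (g a) (g b) * adj (\<tau> i j)) $$ (a div d * ?e + k, b div d * ?e + k)
      = u k a * cnj (u k b)" .
  qed
  finally show "tensor_id_map (\<lambda>i. dx i * d) dy d M ?\<rho> j $$ (a, b) = ?R $$ (a, b)" using ab by simp
qed

text \<open>The inverse property at |\<xi>\<rangle>\<langle>\<xi>| in block \<open>i'\<close>, with
  the input of \<open>N\<close> replaced by its Kraus decomposition. It supplies the assumption
  \<open>left_inverse\<close> of the locale.\<close>

lemma left_inverse_coeff:
  fixes \<xi> :: "nat \<Rightarrow> complex"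
  assumes dil: "minimal_dilation m dx n dy d de M \<tau>" and w: "\<omega> \<in> carrier_mat d d"
    and inv: "ent_left_inverse m dx n dy d d (W_state d \<omega>) M N"
    and i: "i < m" and i': "i' < m" and rs: "r < dx i" "s < dx i"
  defines "u \<equiv> \<lambda>j k x. \<Sum>p<dx i'. \<xi> p * transfer_op (dx i') (dy j) d (de j i') \<omega> (\<tau> i' j) $$ (x, p * de j i' + k)"
  shows "(\<Sum>j<n. \<Sum>k<de j i'. sform (dy j * d) (\<lambda>x y. mm_coeff (\<lambda>j. dy j * d) N j i x y r s) (u j k) (u j k)) =
    (if i = i' then \<xi> r * cnj (\<xi> s) else 0)"
proof -
  let ?\<rho> = "mm_single dx i' (outer (dx i') \<xi> \<xi>)"
  let ?X = "tensor_id_map (\<lambda>i. dx i * d) dy d M (\<lambda>i. tensor_mat (?\<rho> i) (W_state d \<omega>))"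
  have lin: "mm_linear n (\<lambda>j. dy j * d) m dx N"
    using inv by (simp add: ent_left_inverse_def channel_def)
  have X: "?X \<in> mm_carrier n (\<lambda>j. dy j * d)"
    by (simp add: mm_carrier_def tensor_id_map_def)
  have "?\<rho> \<in> mm_carrier m dx" by (rule mm_single_carrier) simp
  then have NX: "N ?X i = ?\<rho> i" using inv i by (simp add: ent_left_inverse_def)
  have "(if i = i' then \<xi> r * cnj (\<xi> s) else 0) = ?\<rho> i $$ (r, s)"
    using rs by (auto simp: mm_single_def outer_def)
  also have "\<dots> = N ?X i $$ (r, s)" by (simp only: NX)
  also have "\<dots> = (\<Sum>j<n. \<Sum>x<dy j * d. \<Sum>y<dy j * d. ?X j $$ (x, y) * mm_coeff (\<lambda>j. dy j * d) N j i x y r s)"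
    by (rule mm_linear_index[OF lin X i rs])
  also have "\<dots> = (\<Sum>j<n. \<Sum>k<de j i'. sform (dy j * d) (\<lambda>x y. mm_coeff (\<lambda>j. dy j * d) N j i x y r s) (u j k) (u j k))"
  proof (rule sum.cong[OF refl])
    fix j assume "j \<in> {..<n}"
    then have j: "j < n" by simp
    have "(\<Sum>x<dy j * d. \<Sum>y<dy j * d. ?X j $$ (x, y) * mm_coeff (\<lambda>j. dy j * d) N j i x y r s)
      = (\<Sum>x<dy j * d. \<Sum>y<dy j * d. \<Sum>k<de j i'. u j k x * cnj (u j k y) * mm_coeff (\<lambda>j. dy j * d) N j i x y r s)"
      unfolding tensor_id_map_dilation[OF dil w i' j] u_def
      by (intro sum.cong refl) (simp add: sum_distrib_right)
    also have "\<dots> = (\<Sum>k<de j i'. \<Sum>x<dy j * d. \<Sum>y<dy j * d. u j k x * cnj (u j k y) * mm_coeff (\<lambda>j. dy j * d) N j i x y r s)"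
      by (simp add: sum.swap[of _ "{..<de j i'}"])
    finally show "(\<Sum>x<dy j * d. \<Sum>y<dy j * d. ?X j $$ (x, y) * mm_coeff (\<lambda>j. dy j * d) N j i x y r s)
      = (\<Sum>k<de j i'. sform (dy j * d) (\<lambda>x y. mm_coeff (\<lambda>j. dy j * d) N j i x y r s) (u j k) (u j k))"
      by (simp add: sform_def)
  qed
  finally show ?thesis by simp
qed

lemma mtrace_ptrace2: "mtrace (ptrace2 p q R) = (\<Sum>x<p * q. R $$ (x, x))"
  by (simp add: mtrace_def ptrace2_def sum_prod_index)

text \<open>The inner product of two columns of \<open>U_i\<close> is the trace of the image under
  \<open>M\<close> of a matrix unit, so trace preservation makes it a Kronecker delta.\<close>

lemma dilation_isometry:
  assumes dil: "minimal_dilation m dx n dy d de M \<tau>" and tp: "trace_preserving m (\<lambda>i. dx i * d) n M"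
    and i: "i < m"
  shows "isometry_mat (block_col (dx i * d) n (\<tau> i))"
  unfolding isometry_mat_iff_orthonormal_cols orthonormal_cols_def
proof (intro allI impI)
  let ?U = "block_col (dx i * d) n (\<tau> i)"
  fix c c' assume "c < dim_col ?U" "c' < dim_col ?U"
  then have c: "c < dx i * d" "c' < dx i * d" by simp_all
  have \<tau>: "\<tau> i j \<in> carrier_mat (dy j * de j i) (dx i * d)" if "j < n" for j
    using dil i that by (simp add: minimal_dilation_def)
  define \<delta> where "\<delta> c x = (if x = c then 1 else 0 :: complex)" for c x :: nat
  \<comment> \<open>The matrix unit |c'\<rangle>\<langle>c|: the trace of \<tau> R times the adjoint
    of \<tau> is the inner product of column \<open>c\<close> with column \<open>c'\<close>.\<close>
  define R where "R = outer (dx i * d) (\<delta> c') (\<delta> c)"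
  let ?X = "mm_single (\<lambda>i. dx i * d) i R"
  have R: "R \<in> carrier_mat (dx i * d) (dx i * d)" by (simp add: R_def)
  have "(\<Sum>x<dim_row ?U. cnj (?U $$ (x, c)) * ?U $$ (x, c')) =
      (\<Sum>j<n. \<Sum>x<dim_row (\<tau> i j). cnj (\<tau> i j $$ (x, c)) * \<tau> i j $$ (x, c'))"
    by (rule sum_block_col[OF c, of "\<lambda>a b. cnj a * b"])
  also have "\<dots> = (\<Sum>j<n. mtrace (M ?X j))"
  proof (rule sum.cong[OF refl])
    fix j assume "j \<in> {..<n}"
    then have j: "j < n" by simp
    have "mtrace (M ?X j) = (\<Sum>x<dy j * de j i. (\<tau> i j * R * adj (\<tau> i j)) $$ (x, x))"
      using dil i j R by (simp add: minimal_dilation_def mtrace_ptrace2)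
    also have "\<dots> = (\<Sum>x<dy j * de j i. cnj (\<tau> i j $$ (x, c)) * \<tau> i j $$ (x, c'))"
    proof (rule sum.cong[OF refl])
      fix x assume "x \<in> {..<dy j * de j i}"
      then have x: "x < dy j * de j i" by simp
      have "(\<tau> i j * R * adj (\<tau> i j)) $$ (x, x) =
          (\<Sum>p<dx i * d. \<Sum>q<dx i * d. \<tau> i j $$ (x, p) * R $$ (p, q) * cnj (\<tau> i j $$ (x, q)))"
        by (rule index_mult3_mat_adj[OF \<tau>[OF j] R x x])
      also have "\<dots> = (\<Sum>p<dx i * d. \<Sum>q<dx i * d. if p = c' then (if q = c then \<tau> i j $$ (x, c') * cnj (\<tau> i j $$ (x, c)) else 0) else 0)"
        by (intro sum.cong refl) (auto simp: R_def outer_def \<delta>_def)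
      also have "\<dots> = (\<Sum>p<dx i * d. if p = c' then (\<Sum>q<dx i * d. if q = c then \<tau> i j $$ (x, c') * cnj (\<tau> i j $$ (x, c)) else 0) else 0)"
        by (intro sum.cong refl) auto
      also have "\<dots> = cnj (\<tau> i j $$ (x, c)) * \<tau> i j $$ (x, c')"
        using c by (simp add: mult.commute)
      finally show "(\<tau> i j * R * adj (\<tau> i j)) $$ (x, x) = cnj (\<tau> i j $$ (x, c)) * \<tau> i j $$ (x, c')" .
    qed
    finally show "(\<Sum>x<dim_row (\<tau> i j). cnj (\<tau> i j $$ (x, c)) * \<tau> i j $$ (x, c')) = mtrace (M ?X j)"
      using \<tau>[OF j] by simp
  qed
  also have "\<dots> = mm_trace m ?X"
    using tp mm_single_carrier[of R "\<lambda>i. dx i * d" i] R by (simp add: trace_preserving_def mm_trace_def)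
  also have "\<dots> = (\<Sum>i'<m. if i' = i then (\<Sum>x<dx i * d. if x = c' then (if c = c' then 1 else 0) else 0) else 0)"
  proof -
    have "mtrace R = (\<Sum>x<dx i * d. if x = c' then (if c = c' then 1 else 0) else 0)"
      unfolding mtrace_def by (intro sum.cong) (auto simp: R_def outer_def \<delta>_def)
    moreover have "mtrace (0\<^sub>m k k) = 0" for k by (simp add: mtrace_def)
    ultimately show ?thesis unfolding mm_trace_def by (intro sum.cong refl) (auto simp: mm_single_def)
  qed
  also have "\<dots> = (if c = c' then 1 else 0)"
    using i c by simp
  finally show "(\<Sum>x<dim_row ?U. cnj (?U $$ (x, c)) * ?U $$ (x, c')) = (if c = c' then 1 else 0)" .
qed

section \<open>Comparison of dimensions\<close>

text \<open>Matrices without entries satisfy every linear relation, so minimality forces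
  \<open>E_ji\<close> to be zero when \<open>X_i\<close> or \<open>Y_j\<close> is.\<close>

lemma lin_indep_mats_empty:
  assumes "lin_indep_mats e F r c" "r = 0 \<or> c = 0"
  shows "e = 0"
proof (rule ccontr)
  assume "e \<noteq> 0"
  have "msum r c {..<e} (\<lambda>k. 1 \<cdot>\<^sub>m F k) = 0\<^sub>m r c"
    using assms(2) by (intro eq_matI) (auto simp: msum_def)
  then have "\<forall>k<e. (1 :: complex) = 0"
    using assms(1) unfolding lin_indep_mats_def by (elim allE[of _ "\<lambda>_. 1"]) simp
  then show False using \<open>e \<noteq> 0\<close> by simp
qed

lemma sum_le_eq_iff:
  fixes f g :: "nat \<Rightarrow> nat"
  assumes "\<And>i. i < m \<Longrightarrow> f i \<le> g i"
  shows "(\<Sum>i<m. f i) = (\<Sum>i<m. g i) \<longleftrightarrow> (\<forall>i<m. f i = g i)"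
  using assms
proof (induction m)
  case (Suc m)
  have "(\<Sum>i<m. f i) \<le> (\<Sum>i<m. g i)" using Suc.prems by (intro sum_mono) simp
  moreover have "f m \<le> g m" using Suc.prems by simp
  ultimately have "(\<Sum>i<Suc m. f i) = (\<Sum>i<Suc m. g i) \<longleftrightarrow> (\<Sum>i<m. f i) = (\<Sum>i<m. g i) \<and> f m = g m"
    by auto
  also have "(\<Sum>i<m. f i) = (\<Sum>i<m. g i) \<longleftrightarrow> (\<forall>i<m. f i = g i)"
    using Suc by simp
  finally show ?case by (auto simp: less_Suc_eq)
qed simp

text \<open>Weighting the inequality of each \<open>U_i\<close> by \<open>dx i\<close> and that of
  each \<open>V_j\<close> by \<open>dy j\<close> produces the same middle term \<open>S\<close>.
  Equality of the outer terms is then equality in every summand.\<close>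

lemma dimension_count:
  fixes dx dy :: "nat \<Rightarrow> nat" and de :: "nat \<Rightarrow> nat \<Rightarrow> nat"
  assumes U: "\<And>i. i < m \<Longrightarrow> dx i * d \<le> (\<Sum>j<n. dy j * de j i)"
    and V: "\<And>j. j < n \<Longrightarrow> (\<Sum>i<m. dx i * de j i) \<le> dy j * d"
    and d: "0 < d"
    and z: "\<And>i j. i < m \<Longrightarrow> j < n \<Longrightarrow> dx i = 0 \<or> dy j = 0 \<Longrightarrow> de j i = 0"
  shows "mm_dim m dx \<le> mm_dim n dy"
    and "mm_dim m dx = mm_dim n dy \<longleftrightarrow>
      (\<forall>i<m. dx i * d = (\<Sum>j<n. dy j * de j i)) \<and> (\<forall>j<n. (\<Sum>i<m. dx i * de j i) = dy j * d)"
proof -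
  define S where "S = (\<Sum>i<m. dx i * (\<Sum>j<n. dy j * de j i))"
  have S: "S = (\<Sum>j<n. dy j * (\<Sum>i<m. dx i * de j i))"
    unfolding S_def sum_distrib_left by (subst sum.swap) (simp add: mult_ac)
  have A: "mm_dim m dx * d = (\<Sum>i<m. dx i * (dx i * d))"
    by (simp add: mm_dim_def sum_distrib_right power2_eq_square mult.assoc)
  have B: "mm_dim n dy * d = (\<Sum>j<n. dy j * (dy j * d))"
    by (simp add: mm_dim_def sum_distrib_right power2_eq_square mult.assoc)
  have AS: "mm_dim m dx * d \<le> S" unfolding A S_def by (intro sum_mono mult_le_mono2) (simp add: U)
  have SB: "S \<le> mm_dim n dy * d" unfolding B S by (intro sum_mono mult_le_mono2) (simp add: V)
  show "mm_dim m dx \<le> mm_dim n dy" using AS SB d by (meson le_trans mult_le_cancel2)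
  have "mm_dim m dx = mm_dim n dy \<longleftrightarrow> mm_dim m dx * d = S \<and> S = mm_dim n dy * d"
    using AS SB d by auto
  also have "mm_dim m dx * d = S \<longleftrightarrow> (\<forall>i<m. dx i * (dx i * d) = dx i * (\<Sum>j<n. dy j * de j i))"
    unfolding A S_def by (rule sum_le_eq_iff) (simp add: U)
  \<comment> \<open>The factor \<open>dx i\<close> cancels unless it is zero, and then
    \<open>z\<close> makes both sides zero.\<close>
  also have "\<dots> \<longleftrightarrow> (\<forall>i<m. dx i * d = (\<Sum>j<n. dy j * de j i))"
    using z by auto
  also have "S = mm_dim n dy * d \<longleftrightarrow> (\<forall>j<n. dy j * (\<Sum>i<m. dx i * de j i) = dy j * (dy j * d))"
    unfolding B S by (rule sum_le_eq_iff) (simp add: V)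
  also have "\<dots> \<longleftrightarrow> (\<forall>j<n. (\<Sum>i<m. dx i * de j i) = dy j * d)"
    using z by auto
  finally show "mm_dim m dx = mm_dim n dy \<longleftrightarrow>
      (\<forall>i<m. dx i * d = (\<Sum>j<n. dy j * de j i)) \<and> (\<forall>j<n. (\<Sum>i<m. dx i * de j i) = dy j * d)" .
qed

section \<open>The formula for the left inverse\<close>

text \<open>Unitarity of \<open>V_j\<close> enters twice: its columns are orthonormal, which fixes
  the coefficients of \<open>N\<close> on them, and they resolve the identity, so that
  \<open>reconstruct\<close> reaches every input.\<close>

lemma ent_left_inverse_unique:
  fixes m n d :: nat and dx dy :: "nat \<Rightarrow> nat" and de :: "nat \<Rightarrow> nat \<Rightarrow> nat"
    and \<tau> \<kappa> :: "nat \<Rightarrow> nat \<Rightarrow> complex mat" and \<omega> :: "complex mat"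
  defines "T \<equiv> \<lambda>i j. transfer_op (dx i) (dy j) d (de j i) \<omega> (\<tau> i j)"
  defines "S \<equiv> \<lambda>i j. T i j * tensor_mat (1\<^sub>m (dx i)) (\<kappa> i j)"
  assumes dil: "minimal_dilation m dx n dy d de M \<tau>" and w: "\<omega> \<in> carrier_mat d d"
    and inv: "ent_left_inverse m dx n dy d d (W_state d \<omega>) M N"
    and \<kappa>: "\<forall>i<m. \<forall>j<n. \<kappa> i j \<in> carrier_mat (de j i) (de j i)"
    and V: "\<forall>j<n. unitary_mat (block_row (dy j * d) m (\<lambda>i. S i j))"
    and \<rho>: "\<rho> \<in> mm_carrier n (\<lambda>j. dy j * d)" and i: "i < m"
  shows "N \<rho> i = msum (dx i) (dx i) {..<n} (\<lambda>j. ptrace2 (dx i) (de j i) (adj (S i j) * \<rho> j * S i j))"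
proof -
  let ?D = "\<lambda>j. dy j * d"
  let ?t = "\<lambda>j i p k x. T i j $$ (x, p * de j i + k)"
  let ?kap = "\<lambda>j i k a. \<kappa> i j $$ (k, a)"
  let ?w = "\<lambda>j i p a x. \<Sum>k<de j i. ?kap j i k a * ?t j i p k x"
  have lin: "mm_linear n ?D m dx N" and cp: "completely_positive n ?D m dx N"
    and tp: "trace_preserving n ?D m N"
    using inv by (simp_all add: ent_left_inverse_def channel_def)
  have T: "T i j \<in> carrier_mat (?D j) (dx i * de j i)" for i j
    unfolding T_def by (rule transfer_op_carrier[OF w])
  have S: "S i j \<in> carrier_mat (?D j) (dx i * de j i)" if "i < m" "j < n" for i j
    unfolding S_def using T tensor_one_carrier \<kappa> that by (blast intro: mult_carrier_mat)
  have Sw: "S i j $$ (x, p * de j i + a) = ?w j i p a x"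
    if "i < m" "j < n" "x < ?D j" "p < dx i" "a < de j i" for i j x p a
    using index_mult_tensor_one_right[OF _ T[of i j] that(3) prod_index_less[OF that(4,5)]] \<kappa> that
    by (simp add: S_def mult.commute)
  have on: "orthonormal_cols (S i j)" if "i < m" "j < n" for i j
  proof (rule orthonormal_cols_block_rowD[of "?D j" m "\<lambda>i. S i j"])
    show "orthonormal_cols (block_row (?D j) m (\<lambda>i. S i j))"
      using V that unfolding isometry_mat_iff_orthonormal_cols[symmetric]
      by (simp add: unitary_mat_def isometry_mat_def)
    show "dim_row (S i j) = ?D j" using S[OF that] by simp
  qed fact
  \<comment> \<open>The parameters are the coefficients of \<open>N\<close>, the columns of
    \<open>T\<close>, the entries of \<open>\<kappa>\<close> and the columns of
    \<open>S\<close>.\<close>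
  interpret inverse_coeffs_basis m n dx ?D de "mm_coeff ?D N" ?t ?kap ?w
  proof (unfold_locales, goal_cases)
    case (1 i j \<psi>)
    then show ?case by (rule choi_form_coeff_nonneg[OF lin cp])
  next
    case (2 i i' r s \<xi>)
    then show ?case unfolding T_def by (rule left_inverse_coeff[OF dil w inv])
  next
    case (3 j u v)
    then show ?case by (rule trace_pres_coeff[OF lin tp])
  next
    case (4 j i p a b)
    have "(\<Sum>x<?D j. ?w j i p a x * cnj (?w j i p b x)) =
        (\<Sum>x<dim_row (S i j). cnj (S i j $$ (x, p * de j i + b)) * S i j $$ (x, p * de j i + a))"
      using S[of i j] 4 by (intro sum.cong) (auto simp: Sw)
    also have "\<dots> = (if p * de j i + b = p * de j i + a then 1 else 0)"
    proof -
      have "p * de j i + b < dim_col (S i j)" "p * de j i + a < dim_col (S i j)"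
        using S[of i j] 4 by (auto simp: prod_index_less)
      then show ?thesis using on[of i j] 4 unfolding orthonormal_cols_def by blast
    qed
    finally show ?case by auto
  qed
  \<comment> \<open>Row orthonormality of \<open>V_j\<close>, with its columns regrouped by block
    \<open>i\<close> and index pair \<open>(p, a)\<close>.\<close>
  have res: "(\<Sum>i<m. \<Sum>p<dx i. \<Sum>a<de j i. ?w j i p a x * cnj (?w j i p a y)) = (if x = y then 1 else 0)"
    if j: "j < n" and xy: "x < ?D j" "y < ?D j" for j x y
  proof -
    let ?V = "block_row (?D j) m (\<lambda>i. S i j)"
    have "?V * adj ?V = 1\<^sub>m (?D j)" using V j by (simp add: unitary_mat_def)
    then have "(if x = y then 1 else 0) = (?V * adj ?V) $$ (x, y)" using xy by simp
    also have "\<dots> = (\<Sum>c<dim_col ?V. ?V $$ (x, c) * cnj (?V $$ (y, c)))"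
      using xy by (subst index_mult_mat_sum) (simp_all del: index_mult_mat(1))
    also have "\<dots> = (\<Sum>i<m. \<Sum>c<dim_col (S i j). S i j $$ (x, c) * cnj (S i j $$ (y, c)))"
      by (rule sum_block_row[OF xy, of "\<lambda>a b. a * cnj b"])
    also have "\<dots> = (\<Sum>i<m. \<Sum>p<dx i. \<Sum>a<de j i. S i j $$ (x, p * de j i + a) * cnj (S i j $$ (y, p * de j i + a)))"
    proof (rule sum.cong[OF refl])
      fix i assume "i \<in> {..<m}"
      then have "dim_col (S i j) = dx i * de j i" using S j by auto
      then show "(\<Sum>c<dim_col (S i j). S i j $$ (x, c) * cnj (S i j $$ (y, c))) =
          (\<Sum>p<dx i. \<Sum>a<de j i. S i j $$ (x, p * de j i + a) * cnj (S i j $$ (y, p * de j i + a)))"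
        by (simp only: sum_prod_index)
    qed
    also have "\<dots> = (\<Sum>i<m. \<Sum>p<dx i. \<Sum>a<de j i. ?w j i p a x * cnj (?w j i p a y))"
      using j xy by (intro sum.cong refl) (simp only: Sw lessThan_iff)
    finally show ?thesis by simp
  qed
  show ?thesis
  proof (rule eq_matI)
    have c: "N \<rho> i \<in> carrier_mat (dx i) (dx i)" by (rule mm_linear_carrier[OF lin \<rho> i])
    let ?R = "msum (dx i) (dx i) {..<n} (\<lambda>j. ptrace2 (dx i) (de j i) (adj (S i j) * \<rho> j * S i j))"
    show "dim_row (N \<rho> i) = dim_row ?R" "dim_col (N \<rho> i) = dim_col ?R"
      using c by (simp_all add: msum_def)
    fix r s assume "r < dim_row ?R" "s < dim_col ?R"
    then have rs: "r < dx i" "s < dx i" by (simp_all add: msum_def)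
    have "N \<rho> i $$ (r, s) = (\<Sum>j<n. \<Sum>x<?D j. \<Sum>y<?D j. \<rho> j $$ (x, y) * mm_coeff ?D N j i x y r s)"
      by (rule mm_linear_index[OF lin \<rho> i rs])
    also have "\<dots> = (\<Sum>j<n. \<Sum>a<de j i. (adj (S i j) * \<rho> j * S i j) $$ (r * de j i + a, s * de j i + a))"
    proof (rule sum.cong[OF refl])
      fix j assume "j \<in> {..<n}"
      then have j: "j < n" by simp
      have \<rho>j: "\<rho> j \<in> carrier_mat (?D j) (?D j)" using \<rho> j by (simp add: mm_carrier_def)
      have aS: "adj (S i j) \<in> carrier_mat (dx i * de j i) (?D j)"
        using S[OF i j] by (auto intro!: carrier_matI)
      \<comment> \<open>The product formula \<open>index_mult3_mat_adj\<close> is applied with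
        \<open>adj (S i j)\<close> as left factor, so the right factor is a double adjoint.\<close>
      have "adj (adj (S i j)) = S i j" by (intro eq_matI) simp_all
      then have e: "(adj (S i j) * \<rho> j * S i j) $$ (c, c') =
          (\<Sum>x<?D j. \<Sum>y<?D j. cnj (S i j $$ (x, c)) * \<rho> j $$ (x, y) * S i j $$ (y, c'))"
        if "c < dx i * de j i" "c' < dx i * de j i" for c c'
        using index_mult3_mat_adj[OF aS \<rho>j that] S[OF i j] that by simp
      have "(\<Sum>x<?D j. \<Sum>y<?D j. \<rho> j $$ (x, y) * mm_coeff ?D N j i x y r s) =
          (\<Sum>a<de j i. \<Sum>x<?D j. \<Sum>y<?D j. cnj (?w j i r a x) * \<rho> j $$ (x, y) * ?w j i s a y)"
        by (rule reconstruct[OF i j rs res[OF j]])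
      also have "\<dots> = (\<Sum>a<de j i. (adj (S i j) * \<rho> j * S i j) $$ (r * de j i + a, s * de j i + a))"
      proof (rule sum.cong[OF refl])
        fix a assume "a \<in> {..<de j i}"
        then have a: "a < de j i" by simp
        show "(\<Sum>x<?D j. \<Sum>y<?D j. cnj (?w j i r a x) * \<rho> j $$ (x, y) * ?w j i s a y) =
            (adj (S i j) * \<rho> j * S i j) $$ (r * de j i + a, s * de j i + a)"
          unfolding e[OF prod_index_less[OF rs(1) a] prod_index_less[OF rs(2) a]]
          by (intro sum.cong refl) (simp only: lessThan_iff Sw[OF i j _ rs(1) a] Sw[OF i j _ rs(2) a])
      qed
      finally show "(\<Sum>x<?D j. \<Sum>y<?D j. \<rho> j $$ (x, y) * mm_coeff ?D N j i x y r s) =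
          (\<Sum>a<de j i. (adj (S i j) * \<rho> j * S i j) $$ (r * de j i + a, s * de j i + a))" .
    qed
    also have "\<dots> = ?R $$ (r, s)" using rs by (simp add: msum_def ptrace2_def)
    finally show "N \<rho> i $$ (r, s) = ?R $$ (r, s)" .
  qed
qed

section \<open>Unitarity, equality of dimensions and uniqueness of the inverse\<close>

theorem mainTheorem4:
  fixes m n d :: nat
    and dx dy :: "nat \<Rightarrow> nat"
    and de :: "nat \<Rightarrow> nat \<Rightarrow> nat"
    and M :: "(nat \<Rightarrow> complex mat) \<Rightarrow> (nat \<Rightarrow> complex mat)"
    and \<tau> :: "nat \<Rightarrow> nat \<Rightarrow> complex mat"
    and \<omega> :: "complex mat"
    and \<kappa> :: "nat \<Rightarrow> nat \<Rightarrow> complex mat"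
  defines "T \<equiv> (\<lambda>i j. tensor_mat (1\<^sub>m (dy j)) \<omega> * tilde_op (dx i) (dy j) d (de j i) (\<tau> i j))"
  defines "V \<equiv> (\<lambda>j. block_row (dy j * d) m (\<lambda>i. T i j * tensor_mat (1\<^sub>m (dx i)) (\<kappa> i j)))"
  defines "U \<equiv> (\<lambda>i. block_col (dx i * d) n (\<lambda>j. \<tau> i j))"
  defines "N0 \<equiv> (\<lambda>\<rho> i. msum (dx i) (dx i) {..<n} (\<lambda>j. ptrace2 (dx i) (de j i)
              (adj (tensor_mat (1\<^sub>m (dx i)) (\<kappa> i j)) * adj (T i j) * \<rho> j * T i j
                 * tensor_mat (1\<^sub>m (dx i)) (\<kappa> i j))))"
  assumes M_channel: "channel m (\<lambda>i. dx i * d) n dy M"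
    and dil: "minimal_dilation m dx n dy d de M \<tau>"
    and \<omega>_carrier: "\<omega> \<in> carrier_mat d d"
    and \<omega>_inv: "invertible_mat \<omega>"
    and \<omega>_norm: "mtrace (adj \<omega> * \<omega>) = 1"
    and rev: "ent_reversible m dx n dy d d (W_state d \<omega>) M"
    and \<kappa>_carrier: "\<forall>i<m. \<forall>j<n. \<kappa> i j \<in> carrier_mat (de j i) (de j i)"
    and \<kappa>_inv: "\<forall>i<m. \<forall>j<n. invertible_mat (\<kappa> i j)"
    and V_iso: "\<forall>j<n. isometry_mat (V j)"
  shows "(\<forall>i<m. isometry_mat (U i))
    \<and> mm_dim m dx \<le> mm_dim n dy
    \<and> ((\<forall>i<m. unitary_mat (U i)) \<and> (\<forall>j<n. unitary_mat (V j)) \<longleftrightarrow> mm_dim m dx = mm_dim n dy)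
    \<and> (mm_dim m dx = mm_dim n dy \<longrightarrow>
         (\<forall>N. ent_left_inverse m dx n dy d d (W_state d \<omega>) M N \<longrightarrow>
            (\<forall>\<rho> \<in> mm_carrier n (\<lambda>j. dy j * d). \<forall>i<m. N \<rho> i = N0 \<rho> i)))"
proof -
  define S where "S = (\<lambda>i j. T i j * tensor_mat (1\<^sub>m (dx i)) (\<kappa> i j))"
  have T: "T i j \<in> carrier_mat (dy j * d) (dx i * de j i)" for i j
    using transfer_op_carrier[OF \<omega>_carrier] unfolding T_def transfer_op_def by blast
  have K: "tensor_mat (1\<^sub>m (dx i)) (\<kappa> i j) \<in> carrier_mat (dx i * de j i) (dx i * de j i)" if "i < m" "j < n" for i j
    using \<kappa>_carrier that by (simp add: tensor_one_carrier)
  have S: "S i j \<in> carrier_mat (dy j * d) (dx i * de j i)" if "i < m" "j < n" for i j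
    unfolding S_def using T K[OF that] by (rule mult_carrier_mat)
  have VS: "V = (\<lambda>j. block_row (dy j * d) m (\<lambda>i. S i j))" by (simp add: V_def S_def)
  have \<tau>: "\<tau> i j \<in> carrier_mat (dy j * de j i) (dx i * d)" if "i < m" "j < n" for i j
    using dil that by (simp add: minimal_dilation_def)
  have Udim: "dim_col (U i) = dx i * d" "i < m \<Longrightarrow> dim_row (U i) = (\<Sum>j<n. dy j * de j i)" for i
    using \<tau> by (auto simp: U_def intro!: sum.cong)
  have Vdim: "dim_row (V j) = dy j * d" "j < n \<Longrightarrow> dim_col (V j) = (\<Sum>i<m. dx i * de j i)" for j
    using S by (auto simp: VS intro!: sum.cong)
  have U_iso: "\<forall>i<m. isometry_mat (U i)"
    using dilation_isometry[OF dil] M_channel by (simp add: U_def channel_def)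
  \<comment> \<open>For \<open>d = 0\<close> the trace in the normalisation of \<omega> would be an
    empty sum.\<close>
  have d: "0 < d"
    using \<omega>_norm \<omega>_carrier by (cases d) (auto simp: mtrace_def)
  have z: "de j i = 0" if "i < m" "j < n" "dx i = 0 \<or> dy j = 0" for i j
    using lin_indep_mats_empty[of "de j i" _ "dy j" "dx i * d"] dil that by (auto simp: minimal_dilation_def)
  have Ule: "dx i * d \<le> (\<Sum>j<n. dy j * de j i)" if "i < m" for i
    using isometry_mat_dim_le[of "U i"] U_iso that by (simp add: Udim)
  have Vle: "(\<Sum>i<m. dx i * de j i) \<le> dy j * d" if "j < n" for j
    using isometry_mat_dim_le[of "V j"] V_iso that by (simp add: Vdim)
  have count: "mm_dim m dx \<le> mm_dim n dy"
    "mm_dim m dx = mm_dim n dy \<longleftrightarrow> (\<forall>i<m. dim_col (U i) = dim_row (U i)) \<and> (\<forall>j<n. dim_col (V j) = dim_row (V j))"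
    using dimension_count[OF Ule Vle d z] by (simp_all add: Udim Vdim)
  \<comment> \<open>For isometries, being unitary and being square are the same.\<close>
  have eq: "(\<forall>i<m. unitary_mat (U i)) \<and> (\<forall>j<n. unitary_mat (V j)) \<longleftrightarrow> mm_dim m dx = mm_dim n dy"
    unfolding count(2) using U_iso V_iso by (metis isometry_mat_unitary unitary_mat_dim)
  have "N \<rho> i = N0 \<rho> i"
    if "mm_dim m dx = mm_dim n dy" and inv: "ent_left_inverse m dx n dy d d (W_state d \<omega>) M N"
      and \<rho>: "\<rho> \<in> mm_carrier n (\<lambda>j. dy j * d)" and i: "i < m" for N \<rho> i
  proof -
    have V: "\<forall>j<n. unitary_mat (block_row (dy j * d) m (\<lambda>i. S i j))"
      using eq that(1) unfolding VS by blast
    have "N \<rho> i = msum (dx i) (dx i) {..<n} (\<lambda>j. ptrace2 (dx i) (de j i) (adj (S i j) * \<rho> j * S i j))"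
      using ent_left_inverse_unique[OF dil \<omega>_carrier inv \<kappa>_carrier _ \<rho> i] V
      unfolding S_def T_def transfer_op_def by blast
    also have "\<dots> = N0 \<rho> i"
      unfolding N0_def msum_def
    proof (intro cong_mat refl, clarsimp, intro sum.cong refl)
      fix a b j assume ab: "j \<in> {..<n}"
      then have j: "j < n" by simp
      have \<rho>j: "\<rho> j \<in> carrier_mat (dy j * d) (dy j * d)" using \<rho> j by (simp add: mm_carrier_def)
      let ?K = "tensor_mat (1\<^sub>m (dx i)) (\<kappa> i j)"
      \<comment> \<open>\<open>N0\<close> has the factors of \<open>S i j\<close> and of its adjoint
        written out; only \<open>adj_mult\<close> and associativity separate the two forms.\<close>
      have "adj (S i j) = adj ?K * adj (T i j)"
        unfolding S_def by (rule adj_mult[OF T K[OF i j]])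
      moreover have "adj ?K * adj (T i j) * \<rho> j * S i j = adj ?K * adj (T i j) * \<rho> j * T i j * ?K"
        unfolding S_def using \<rho>j T[of i j] K[OF i j]
        by (subst assoc_mult_mat[of _ "dx i * de j i" "dy j * d" _ "dx i * de j i" _ "dx i * de j i"])
           (auto intro!: mult_carrier_mat carrier_matI)
      ultimately show "ptrace2 (dx i) (de j i) (adj (S i j) * \<rho> j * S i j) $$ (a, b) =
          ptrace2 (dx i) (de j i) (adj ?K * adj (T i j) * \<rho> j * T i j * ?K) $$ (a, b)"
        by simp
    qed
    finally show ?thesis .
  qed
  then show ?thesis using U_iso count(1) eq by blast
qed

end
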